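(* Let $n,s\ge1$, $h>0$, $a_{ij},b_i\in\mathbb{R}$ with all $b_i\neq0$. Let $\boldsymbol{l}\colon\mathrm{Skew}(n)\to\mathbb{R}$ be a smooth reduced Lagrangian, i.e. the left-trivialized Lagrangian $L(U,\Omega)=\boldsymbol{l}(\Omega)$ on $SO(n)\times\mathrm{Skew}(n)$ is $SO(n)$-invariant, assumed hyperregular, and let $\mathbf{h}\colon\mathrm{Skew}(n)\to\mathbb{R}$ be the reduced Hamiltonian, $H(U,\mu)=\mathbf{h}(\mu)$. (A) (Invariance.) For $g_0,g_1\in SO(n)$ consider the problem of extremizing (finding stationary values of) $h\sum_{i=1}^s b_i\boldsymbol{l}(\Omega_i)$ over $\{\Omega_i\}_{i=1}^s\subset\mathrm{Skew}(n)$, $\{U_i\}_{i=1}^s\subset SO(n)$ subject to $U_i=\mathbb{P}(g_0+h\sum_{j}a_{ij}U_j\Omega_j)$ and $g_1=\mathbb{P}(g_0+h\sum_i b_iU_i\Omega_i)$. For every $g\in SO(n)$, $(\{\Omega_i\},\{U_i\})$ is feasible (respectively stationary) for $(g_0,g_1)$ if and only if $(\{\Omega_i\},\{gU_i\})$ is feasible (respectively stationary) for $(gg_0,gg_1)$, with the same value; hence the discrete Lagrangian $L_d(g_0,g_1)$ given by the extremal value satisfies $L_d(gg_0,gg_1)=L_d(g_0,g_1)$. (B) (Reduced integrator.) There is a neighborhood $V$ of $I$ in $\mathbb{R}^{n\times n}$, depending only on $n$, such that the following holds. Let $g_0,g_1,U_1,\dots,U_s\in SO(n)$ and $\mu_1,\dots,\mu_s,\Omega_1,\dots,\Omega_s,\Lambda,p_0,p_1\in\mathrm{Skew}(n)$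 be such that each $A_i:=g_0+h\sum_ja_{ij}U_j\Omega_j$ has positive determinant, the map $\tilde\phi$ (see context) is invertible, and $g_1^T(g_0+h\sum_ib_iU_i\Omega_i)\in V$. Set $f_0=g_0^Tg_1$ and $\Theta_i=U_i^Tg_1$. Then the equations (for all $i,k=1,\dots,s$) $$\begin{cases}\mu_k=-\mathrm{Asym}(U_k^Tg_1\Lambda)+h\sum_{i}\frac{b_i}{b_k}(\tilde\pi_i\circ\tilde\phi^{-1}\circ\tilde\psi_k)^*\big(\frac{\partial H}{\partial U}(U_i,\mu_i)-\mathrm{Asym}(U_i^Tg_1\Lambda\Omega_i^T)\big),\\ g_1=\mathbb{P}\big(g_0+h\sum_{i}b_iU_i\Omega_i\big),\\ U_i=\mathbb{P}\big(g_0+h\sum_{j}a_{ij}U_j\Omega_j\big),\\ \mathrm{Asym}(g_0^Tg_1\Lambda)=-p_0+h\sum_{i}b_i(\tilde\pi_i\circ\tilde\phi^{-1}\circ\tilde\varphi)^*\big(\frac{\partial H}{\partial U}(U_i,\mu_i)-\mathrm{Asym}(U_i^Tg_1\Lambda\Omega_i^T)\big),\\ p_1=\mathrm{Asym}\big(g_1^T(g_0+h\sum_{i}b_iU_i\Omega_i)\Lambda^T\big),\\ \Omega_i=\frac{\partial H}{\partial\mu}(U_i,\mu_i)\end{cases}$$ hold if and only if (for all $i,k=1,\dots,s$) $$\begin{cases}\mu_k=-\mathrm{Asym}(\Theta_k\Lambda)-h\sum_{i}\frac{b_i}{b_k}T_{i,k}(\mathrm{Asym}(\Theta_i\Lambda\Omega_i^T)),\\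 0=\mathrm{Asym}\big(f_0^T+h\sum_{i}b_i\Theta_i^T\Omega_i\big),\\ \Theta_i^T=\mathbb{P}\big(f_0^T+h\sum_{j}a_{ij}\Theta_j^T\Omega_j\big),\\ \mathrm{Asym}(f_0\Lambda)=-p_0-h\sum_{i}b_iR_i(\mathrm{Asym}(\Theta_i\Lambda\Omega_i^T)),\\ p_1=\mathrm{Asym}\big((f_0^T+h\sum_{i}b_i\Theta_i^T\Omega_i)\Lambda^T\big),\\ \Omega_i=\frac{\partial\mathbf{h}}{\partial\mu}(\mu_i),\end{cases}$$ where, with $\hat A_i:=f_0^T+h\sum_ja_{ij}\Theta_j^T\Omega_j$, the maps $T_{i,k},R_i\colon\mathrm{Skew}(n)\to\mathrm{Skew}(n)$ are given by $$T_{i,k}(S)=\mathrm{Asym}\Big(\Theta_k\sum_{l=1}^sa_{lk}\,d\mathbb{P}_{\hat A_l}^*(S_l)\Big),\qquad R_i(S)=\mathrm{Asym}\Big(f_0\sum_{l=1}^sd\mathbb{P}_{\hat A_l}^*(S_l)\Big),$$ with $(S_1,\dots,S_s)\in\mathrm{Skew}(n)^s$ the unique solution of $$S_j-\mathrm{Asym}\Big(h\Theta_j\sum_{l=1}^sa_{lj}\,d\mathbb{P}_{\hat A_l}^*(S_l)\,\Omega_j^T\Big)=\delta_{ij}S,\qquad j=1,\dots,s.$$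
   Context: $\mathrm{Skew}(n)$ is the space of real skew-symmetric $n\times n$ matrices, with inner product $\langle\Omega,\tilde\Omega\rangle=\sum_{i<j}\Omega_{ij}\tilde\Omega_{ij}=\tfrac12\mathrm{tr}(\Omega\tilde\Omega^T)$, used to identify $\mathrm{Skew}(n)^*$ with $\mathrm{Skew}(n)$; $\mathbb{R}^{n\times n}$ carries the inner product $\mathrm{tr}(AB^T)$; $\mathrm{Skew}(n)^s$ carries the sum of the inner products; $^*$ on linear maps denotes the adjoint with respect to these. $\mathrm{Asym}(A)=A-A^T$. All sums run over $1,\dots,s$. Hyperregular means that $(U,\Omega)\mapsto(U,\frac{\partial L}{\partial\Omega}(U,\Omega))$ is a diffeomorphism of $SO(n)\times\mathrm{Skew}(n)$; the corresponding Hamiltonian is $H(U,\mu)=\langle\mu,\Omega\rangle-L(U,\Omega)$ with $\mu=\frac{\partial L}{\partial\Omega}(U,\Omega)$. Polar projection: every $A\in\mathbb{R}^{n\times n}$ with $\det A>0$ is uniquely $A=UP$ with $U\in SO(n)$ and $P$ symmetric positive-definite; $\mathbb{P}(A):=U$. Its left-trivialized tangent map $d\mathbb{P}_A\colon\mathbb{R}^{n\times n}\to\mathrm{Skew}(n)$ is defined by: if $A(0)=A$, $\dot A(0)=B$, $U(t)=\mathbb{P}(A(t))$, then $\dot U(0)=\mathbb{P}(A)\,d\mathbb{P}_A(B)$. Its adjoint is $d\mathbb{P}_A^*\colon\mathrm{Skew}(n)\to\mathbb{R}^{n\times n}$, explicitly $d\mathbb{P}_A^*(S)=UX$ where $A=UP$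 is the polar decomposition and $X$ is the unique solution of $PX+XP=S$. Linear maps (with $A_i=g_0+h\sum_ja_{ij}U_j\Omega_j$): - $\tilde\psi_k\colon\mathrm{Skew}(n)\to\mathrm{Skew}(n)^s$, $\tilde\psi_k(\delta)=\{d\mathbb{P}_{A_i}(a_{ik}U_k\delta)\}_{i=1}^s$; - $\tilde\phi\colon\mathrm{Skew}(n)^s\to\mathrm{Skew}(n)^s$, $\tilde\phi(\{X_i\})=\{X_i-d\mathbb{P}_{A_i}(h\sum_{j}a_{ij}U_jX_j\Omega_j)\}_{i=1}^s$; - $\tilde\pi_i\colon\mathrm{Skew}(n)^s\to\mathrm{Skew}(n)$, the $i$-th coordinate projection; - $\tilde\varphi\colon\mathrm{Skew}(n)\to\mathrm{Skew}(n)^s$, $\tilde\varphi(\delta)=\{d\mathbb{P}_{A_i}(g_0\delta)\}_{i=1}^s$. $\partial/\partial\mu$ and $\partial/\partial\Omega$ are gradients in $\mathrm{Skew}(n)$ with respect to $\langle\cdot,\cdot\rangle$; $\frac{\partial H}{\partial U}\in\mathrm{Skew}(n)$ is the left-trivialized derivative: $\frac{d}{dt}\big|_{t=0}H(U(t),\mu)=\langle\frac{\partial H}{\partial U},\eta\rangle$ for $U(0)=U$, $\dot U(0)=U\eta$. *)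

theory Defs
  imports "HOL-Analysis.Analysis"
begin

section \<open>Matrices\<close>

definition SO :: "(real^'n^'n) set" where
  "SO = {U. rotation_matrix U}"

definition Skew :: "(real^'n^'n) set" where
  "Skew = {A. transpose A = - A}"

definition Asym :: "real^'n^'n \<Rightarrow> real^'n^'n" where
  "Asym A = A - transpose A"

definition skew_inner :: "real^'n^'n \<Rightarrow> real^'n^'n \<Rightarrow> real" where
  "skew_inner X Y = trace (X ** transpose Y) / 2"

text \<open>The inner product of the type of matrices is \<open>tr (A B\<^sup>T)\<close>.\<close>

lemma matrix_inner_eq_trace:
  fixes A B :: "real^'n^'n"
  shows "A \<bullet> B = trace (A ** transpose B)"
  by (simp add: inner_vec_def trace_def matrix_matrix_mult_def transpose_def)

text \<open>
  The adjoint of a linear map \<open>F\<close> defined on the subspace \<open>V\<close>, for the inner product \<open>ipV\<close> on \<open>V\<close>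
  and the inner product \<open>ipW\<close> on the codomain. The library's \<open>adjoint\<close> does not apply, since it is
  tied to whole types and to their standard inner products, whereas \<open>skew_inner\<close> is half the
  standard one.
\<close>

definition adjoint_on ::
  "'a set \<Rightarrow> ('a \<Rightarrow> 'a \<Rightarrow> real) \<Rightarrow> ('b \<Rightarrow> 'b \<Rightarrow> real) \<Rightarrow> ('a \<Rightarrow> 'b) \<Rightarrow> 'b \<Rightarrow> 'a" where
  "adjoint_on V ipV ipW F w = (THE v. v \<in> V \<and> (\<forall>x\<in>V. ipW (F x) w = ipV x v))"

definition skew_adjoint ::
  "(real^'n^'n \<Rightarrow> real^'n^'n) \<Rightarrow> real^'n^'n \<Rightarrow> real^'n^'n" where
  "skew_adjoint F = adjoint_on Skew skew_inner skew_inner F"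


section \<open>The polar projection\<close>

definition pos_def :: "real^'n^'n \<Rightarrow> bool" where
  "pos_def P \<longleftrightarrow> (\<forall>x. x \<noteq> 0 \<longrightarrow> 0 < x \<bullet> (P *v x))"

text \<open>Only meaningful for matrices of positive determinant, as is \<open>dpolar\<close> below.\<close>

definition polar :: "real^'n^'n \<Rightarrow> real^'n^'n" where
  "polar A = (THE U. U \<in> SO \<and> (\<exists>P. transpose P = P \<and> pos_def P \<and> A = U ** P))"

definition dpolar :: "real^'n^'n \<Rightarrow> real^'n^'n \<Rightarrow> real^'n^'n" where
  "dpolar A B = (THE X. X \<in> Skew \<and>
     (\<forall>\<gamma> :: real \<Rightarrow> real^'n^'n. \<gamma> 0 = A \<and> (\<gamma> has_vector_derivative B) (at 0) \<longrightarrow>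
        ((\<lambda>t. polar (\<gamma> t)) has_vector_derivative polar A ** X) (at 0)))"

definition dpolar_adjoint :: "real^'n^'n \<Rightarrow> real^'n^'n \<Rightarrow> real^'n^'n" where
  "dpolar_adjoint A = adjoint_on UNIV (\<bullet>) skew_inner (dpolar A)"


section \<open>Smooth maps between subsets of Euclidean spaces\<close>

text \<open>For open \<open>W\<close>. As the domain is finite-dimensional, continuity of all \<open>\<lambda>x. f' x v\<close> amounts to
  continuity of \<open>f'\<close> in the operator norm.\<close>

primrec Ck_on ::
  "nat \<Rightarrow> ('a::euclidean_space \<Rightarrow> 'b::real_normed_vector) \<Rightarrow> 'a set \<Rightarrow> bool" where
  "Ck_on 0 f W \<longleftrightarrow> continuous_on W f"
| "Ck_on (Suc k) f W \<longleftrightarrow>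
     (\<exists>f'. (\<forall>x\<in>W. (f has_derivative f' x) (at x)) \<and> (\<forall>v. Ck_on k (\<lambda>x. f' x v) W))"

text \<open>
  A map on an arbitrary subset is smooth if it extends locally to a smooth map on an open set; for
  embedded submanifolds, such as \<open>Skew\<close> and \<open>SO \<times> Skew\<close>, this is smoothness in the sense of manifolds.
\<close>

definition smooth_map_on ::
  "'a::euclidean_space set \<Rightarrow> ('a \<Rightarrow> 'b::real_normed_vector) \<Rightarrow> bool" where
  "smooth_map_on X f \<longleftrightarrow>
     (\<forall>x\<in>X. \<exists>W F. open W \<and> x \<in> W \<and> (\<forall>k. Ck_on k F W) \<and> (\<forall>y\<in>X \<inter> W. f y = F y))"

definition diffeomorphism_on ::
  "'a::euclidean_space set \<Rightarrow> 'b::euclidean_space set \<Rightarrow> ('a \<Rightarrow> 'b) \<Rightarrow> bool" where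
  "diffeomorphism_on X Y f \<longleftrightarrow>
     bij_betw f X Y \<and> smooth_map_on X f \<and> smooth_map_on Y (inv_into X f)"


section \<open>Lagrangian and Hamiltonian\<close>

definition skew_grad :: "(real^'n^'n \<Rightarrow> real) \<Rightarrow> real^'n^'n \<Rightarrow> real^'n^'n" where
  "skew_grad f X =
     (THE G. G \<in> Skew \<and> (f has_derivative (\<lambda>Y. skew_inner G Y)) (at X within Skew))"

definition left_grad :: "(real^'n^'n \<Rightarrow> real) \<Rightarrow> real^'n^'n \<Rightarrow> real^'n^'n" where
  "left_grad F U = (THE G. G \<in> Skew \<and>
     (\<forall>\<eta>\<in>Skew. \<forall>\<gamma> :: real \<Rightarrow> real^'n^'n.
        (\<forall>t. \<gamma> t \<in> SO) \<and> \<gamma> 0 = U \<and> (\<gamma> has_vector_derivative U ** \<eta>) (at 0) \<longrightarrow>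
        ((\<lambda>t. F (\<gamma> t)) has_real_derivative skew_inner G \<eta>) (at 0)))"

definition hyperregular :: "(real^'n^'n \<Rightarrow> real^'n^'n \<Rightarrow> real) \<Rightarrow> bool" where
  "hyperregular L \<longleftrightarrow>
     diffeomorphism_on (SO \<times> Skew) (SO \<times> Skew) (\<lambda>(U, \<Omega>). (U, skew_grad (L U) \<Omega>))"

definition hamiltonian ::
  "(real^'n^'n \<Rightarrow> real^'n^'n \<Rightarrow> real) \<Rightarrow> real^'n^'n \<Rightarrow> real^'n^'n \<Rightarrow> real" where
  "hamiltonian L U \<mu> =
     (let \<Omega> = (THE \<Omega>. \<Omega> \<in> Skew \<and> skew_grad (L U) \<Omega> = \<mu>) in skew_inner \<mu> \<Omega> - L U \<Omega>)"

text \<open>\<open>l\<close> is the reduced Lagrangian of \<open>L\<close>, and \<open>hred\<close> the reduced Hamiltonian.\<close>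

definition reduced_setup ::
  "(real^'n^'n \<Rightarrow> real^'n^'n \<Rightarrow> real) \<Rightarrow> (real^'n^'n \<Rightarrow> real) \<Rightarrow> (real^'n^'n \<Rightarrow> real) \<Rightarrow> bool" where
  "reduced_setup L l hred \<longleftrightarrow>
     smooth_map_on Skew l \<and>
     (\<forall>U\<in>SO. \<forall>\<Omega>\<in>Skew. L U \<Omega> = l \<Omega>) \<and>
     hyperregular L \<and>
     (\<forall>U\<in>SO. \<forall>\<mu>\<in>Skew. hamiltonian L U \<mu> = hred \<mu>)"


section \<open>The discrete variational problem\<close>

text \<open>
  Stages are indexed by \<open>{1..s}\<close>; families indexed by stages are functions on \<open>nat\<close> of which only the
  values on \<open>{1..s}\<close> are used. The point below is \<open>A\<^sub>i\<close> for the weights \<open>w = a i\<close>.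
\<close>

definition rk_point ::
  "nat \<Rightarrow> real \<Rightarrow> (nat \<Rightarrow> real) \<Rightarrow> real^'n^'n \<Rightarrow> (nat \<Rightarrow> real^'n^'n) \<Rightarrow> (nat \<Rightarrow> real^'n^'n) \<Rightarrow> real^'n^'n"
  where
  "rk_point s h w g U \<Omega> = g + h *\<^sub>R (\<Sum>j=1..s. w j *\<^sub>R (U j ** \<Omega> j))"

definition objective ::
  "nat \<Rightarrow> real \<Rightarrow> (nat \<Rightarrow> real) \<Rightarrow> (real^'n^'n \<Rightarrow> real) \<Rightarrow>
   (nat \<Rightarrow> real^'n^'n) \<Rightarrow> (nat \<Rightarrow> real^'n^'n) \<Rightarrow> real" where
  "objective s h b l \<Omega> U = h * (\<Sum>i=1..s. b i * l (\<Omega> i))"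

text \<open>The determinant conditions put the arguments of \<open>polar\<close> into its domain.\<close>

definition feasible ::
  "nat \<Rightarrow> real \<Rightarrow> (nat \<Rightarrow> nat \<Rightarrow> real) \<Rightarrow> (nat \<Rightarrow> real) \<Rightarrow> real^'n^'n \<Rightarrow> real^'n^'n \<Rightarrow>
   (nat \<Rightarrow> real^'n^'n) \<Rightarrow> (nat \<Rightarrow> real^'n^'n) \<Rightarrow> bool" where
  "feasible s h a b g0 g1 \<Omega> U \<longleftrightarrow>
     (\<forall>i\<in>{1..s}. \<Omega> i \<in> Skew \<and> U i \<in> SO \<and>
        0 < det (rk_point s h (a i) g0 U \<Omega>) \<and> U i = polar (rk_point s h (a i) g0 U \<Omega>)) \<and>
     0 < det (rk_point s h b g0 U \<Omega>) \<and> g1 = polar (rk_point s h b g0 U \<Omega>)"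

text \<open>A feasible point is stationary if the objective has derivative zero along every smooth
  variation through feasible points.\<close>

definition stationary ::
  "nat \<Rightarrow> real \<Rightarrow> (nat \<Rightarrow> nat \<Rightarrow> real) \<Rightarrow> (nat \<Rightarrow> real) \<Rightarrow> (real^'n^'n \<Rightarrow> real) \<Rightarrow>
   real^'n^'n \<Rightarrow> real^'n^'n \<Rightarrow> (nat \<Rightarrow> real^'n^'n) \<Rightarrow> (nat \<Rightarrow> real^'n^'n) \<Rightarrow> bool" where
  "stationary s h a b l g0 g1 \<Omega> U \<longleftrightarrow>
     feasible s h a b g0 g1 \<Omega> U \<and>
     (\<forall>\<epsilon>>0. \<forall>\<Omega>v Uv :: nat \<Rightarrow> real \<Rightarrow> real^'n^'n.
        (\<forall>i\<in>{1..s}. smooth_map_on {-\<epsilon><..<\<epsilon>} (\<Omega>v i) \<and> smooth_map_on {-\<epsilon><..<\<epsilon>} (Uv i) \<and>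
            \<Omega>v i 0 = \<Omega> i \<and> Uv i 0 = U i) \<and>
        (\<forall>t\<in>{-\<epsilon><..<\<epsilon>}. feasible s h a b g0 g1 (\<lambda>i. \<Omega>v i t) (\<lambda>i. Uv i t)) \<longrightarrow>
        ((\<lambda>t. objective s h b l (\<lambda>i. \<Omega>v i t) (\<lambda>i. Uv i t)) has_real_derivative 0) (at 0))"

definition extremal_values ::
  "nat \<Rightarrow> real \<Rightarrow> (nat \<Rightarrow> nat \<Rightarrow> real) \<Rightarrow> (nat \<Rightarrow> real) \<Rightarrow> (real^'n^'n \<Rightarrow> real) \<Rightarrow>
   real^'n^'n \<Rightarrow> real^'n^'n \<Rightarrow> real set" where
  "extremal_values s h a b l g0 g1 =
     {objective s h b l \<Omega> U | \<Omega> U. stationary s h a b l g0 g1 \<Omega> U}"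

text \<open>Meaningful when there is exactly one extremal value.\<close>

definition discrete_lagrangian ::
  "nat \<Rightarrow> real \<Rightarrow> (nat \<Rightarrow> nat \<Rightarrow> real) \<Rightarrow> (nat \<Rightarrow> real) \<Rightarrow> (real^'n^'n \<Rightarrow> real) \<Rightarrow>
   real^'n^'n \<Rightarrow> real^'n^'n \<Rightarrow> real" where
  "discrete_lagrangian s h a b l g0 g1 = (THE v. v \<in> extremal_values s h a b l g0 g1)"


section \<open>The integrator on the group\<close>

definition Skew_power :: "nat \<Rightarrow> (nat \<Rightarrow> real^'n^'n) set" where
  "Skew_power s = {1..s} \<rightarrow>\<^sub>E Skew"

definition psi_map ::
  "nat \<Rightarrow> real \<Rightarrow> (nat \<Rightarrow> nat \<Rightarrow> real) \<Rightarrow> real^'n^'n \<Rightarrow> (nat \<Rightarrow> real^'n^'n) \<Rightarrow> (nat \<Rightarrow> real^'n^'n) \<Rightarrow>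
   nat \<Rightarrow> real^'n^'n \<Rightarrow> nat \<Rightarrow> real^'n^'n" where
  "psi_map s h a g0 U \<Omega> k \<delta> =
     (\<lambda>i\<in>{1..s}. dpolar (rk_point s h (a i) g0 U \<Omega>) (a i k *\<^sub>R (U k ** \<delta>)))"

definition phi_map ::
  "nat \<Rightarrow> real \<Rightarrow> (nat \<Rightarrow> nat \<Rightarrow> real) \<Rightarrow> real^'n^'n \<Rightarrow> (nat \<Rightarrow> real^'n^'n) \<Rightarrow> (nat \<Rightarrow> real^'n^'n) \<Rightarrow>
   (nat \<Rightarrow> real^'n^'n) \<Rightarrow> nat \<Rightarrow> real^'n^'n" where
  "phi_map s h a g0 U \<Omega> X =
     (\<lambda>i\<in>{1..s}. X i - dpolar (rk_point s h (a i) g0 U \<Omega>)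
        (h *\<^sub>R (\<Sum>j=1..s. a i j *\<^sub>R (U j ** X j ** \<Omega> j))))"

definition phi_invertible ::
  "nat \<Rightarrow> real \<Rightarrow> (nat \<Rightarrow> nat \<Rightarrow> real) \<Rightarrow> real^'n^'n \<Rightarrow> (nat \<Rightarrow> real^'n^'n) \<Rightarrow> (nat \<Rightarrow> real^'n^'n) \<Rightarrow>
   bool" where
  "phi_invertible s h a g0 U \<Omega> \<longleftrightarrow>
     bij_betw (phi_map s h a g0 U \<Omega>) (Skew_power s) (Skew_power s)"

definition phi_inverse ::
  "nat \<Rightarrow> real \<Rightarrow> (nat \<Rightarrow> nat \<Rightarrow> real) \<Rightarrow> real^'n^'n \<Rightarrow> (nat \<Rightarrow> real^'n^'n) \<Rightarrow> (nat \<Rightarrow> real^'n^'n) \<Rightarrow>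
   (nat \<Rightarrow> real^'n^'n) \<Rightarrow> nat \<Rightarrow> real^'n^'n" where
  "phi_inverse s h a g0 U \<Omega> = inv_into (Skew_power s) (phi_map s h a g0 U \<Omega>)"

definition pi_map :: "nat \<Rightarrow> (nat \<Rightarrow> real^'n^'n) \<Rightarrow> real^'n^'n" where
  "pi_map i X = X i"

definition varphi_map ::
  "nat \<Rightarrow> real \<Rightarrow> (nat \<Rightarrow> nat \<Rightarrow> real) \<Rightarrow> real^'n^'n \<Rightarrow> (nat \<Rightarrow> real^'n^'n) \<Rightarrow> (nat \<Rightarrow> real^'n^'n) \<Rightarrow>
   real^'n^'n \<Rightarrow> nat \<Rightarrow> real^'n^'n" where
  "varphi_map s h a g0 U \<Omega> \<delta> = (\<lambda>i\<in>{1..s}. dpolar (rk_point s h (a i) g0 U \<Omega>) (g0 ** \<delta>))"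

definition group_integrator ::
  "nat \<Rightarrow> real \<Rightarrow> (nat \<Rightarrow> nat \<Rightarrow> real) \<Rightarrow> (nat \<Rightarrow> real) \<Rightarrow> (real^'n^'n \<Rightarrow> real^'n^'n \<Rightarrow> real) \<Rightarrow>
   real^'n^'n \<Rightarrow> real^'n^'n \<Rightarrow> (nat \<Rightarrow> real^'n^'n) \<Rightarrow> (nat \<Rightarrow> real^'n^'n) \<Rightarrow> (nat \<Rightarrow> real^'n^'n) \<Rightarrow>
   real^'n^'n \<Rightarrow> real^'n^'n \<Rightarrow> real^'n^'n \<Rightarrow> bool" where
  "group_integrator s h a b H g0 g1 U \<mu> \<Omega> \<Lambda> p0 p1 \<longleftrightarrow>
     (let Z = (\<lambda>i. left_grad (\<lambda>V. H V (\<mu> i)) (U i)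
                   - Asym (transpose (U i) ** g1 ** \<Lambda> ** transpose (\<Omega> i)))
      in
      (\<forall>k\<in>{1..s}. \<mu> k = - Asym (transpose (U k) ** g1 ** \<Lambda>)
         + h *\<^sub>R (\<Sum>i=1..s. (b i / b k) *\<^sub>R
             skew_adjoint (pi_map i \<circ> phi_inverse s h a g0 U \<Omega> \<circ> psi_map s h a g0 U \<Omega> k) (Z i))) \<and>
      g1 = polar (rk_point s h b g0 U \<Omega>) \<and>
      (\<forall>i\<in>{1..s}. U i = polar (rk_point s h (a i) g0 U \<Omega>)) \<and>
      Asym (transpose g0 ** g1 ** \<Lambda>) = - p0
         + h *\<^sub>R (\<Sum>i=1..s. b i *\<^sub>R
             skew_adjoint (pi_map i \<circ> phi_inverse s h a g0 U \<Omega> \<circ> varphi_map s h a g0 U \<Omega>) (Z i)) \<and>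
      p1 = Asym (transpose g1 ** rk_point s h b g0 U \<Omega> ** transpose \<Lambda>) \<and>
      (\<forall>i\<in>{1..s}. \<Omega> i = skew_grad (H (U i)) (\<mu> i)))"


section \<open>The reduced integrator\<close>

text \<open>In this section \<open>A l\<close> stands for the reduced stage points (written with a hat in the theorem).\<close>

definition stage_solution ::
  "nat \<Rightarrow> real \<Rightarrow> (nat \<Rightarrow> nat \<Rightarrow> real) \<Rightarrow> (nat \<Rightarrow> real^'n^'n) \<Rightarrow> (nat \<Rightarrow> real^'n^'n) \<Rightarrow>
   (nat \<Rightarrow> real^'n^'n) \<Rightarrow> nat \<Rightarrow> real^'n^'n \<Rightarrow> (nat \<Rightarrow> real^'n^'n) \<Rightarrow> bool" where
  "stage_solution s h a A \<Theta> \<Omega> i S Sv \<longleftrightarrow>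
     Sv \<in> Skew_power s \<and>
     (\<forall>j\<in>{1..s}.
        Sv j - Asym (h *\<^sub>R (\<Theta> j ** (\<Sum>l=1..s. a l j *\<^sub>R dpolar_adjoint (A l) (Sv l))
                          ** transpose (\<Omega> j)))
        = (if i = j then S else 0))"

definition T_map ::
  "nat \<Rightarrow> real \<Rightarrow> (nat \<Rightarrow> nat \<Rightarrow> real) \<Rightarrow> (nat \<Rightarrow> real^'n^'n) \<Rightarrow> (nat \<Rightarrow> real^'n^'n) \<Rightarrow>
   (nat \<Rightarrow> real^'n^'n) \<Rightarrow> nat \<Rightarrow> nat \<Rightarrow> real^'n^'n \<Rightarrow> real^'n^'n" where
  "T_map s h a A \<Theta> \<Omega> i k S =
     (let Sv = (THE Sv. stage_solution s h a A \<Theta> \<Omega> i S Sv)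
      in Asym (\<Theta> k ** (\<Sum>l=1..s. a l k *\<^sub>R dpolar_adjoint (A l) (Sv l))))"

definition R_map ::
  "nat \<Rightarrow> real \<Rightarrow> (nat \<Rightarrow> nat \<Rightarrow> real) \<Rightarrow> (nat \<Rightarrow> real^'n^'n) \<Rightarrow> (nat \<Rightarrow> real^'n^'n) \<Rightarrow>
   (nat \<Rightarrow> real^'n^'n) \<Rightarrow> real^'n^'n \<Rightarrow> nat \<Rightarrow> real^'n^'n \<Rightarrow> real^'n^'n" where
  "R_map s h a A \<Theta> \<Omega> f0 i S =
     (let Sv = (THE Sv. stage_solution s h a A \<Theta> \<Omega> i S Sv)
      in Asym (f0 ** (\<Sum>l=1..s. dpolar_adjoint (A l) (Sv l))))"

definition reduced_point ::
  "nat \<Rightarrow> real \<Rightarrow> (nat \<Rightarrow> real) \<Rightarrow> real^'n^'n \<Rightarrow> (nat \<Rightarrow> real^'n^'n) \<Rightarrow> (nat \<Rightarrow> real^'n^'n) \<Rightarrow> real^'n^'n"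
  where
  "reduced_point s h w f0 \<Theta> \<Omega> = rk_point s h w (transpose f0) (\<lambda>j. transpose (\<Theta> j)) \<Omega>"

definition reduced_integrator ::
  "nat \<Rightarrow> real \<Rightarrow> (nat \<Rightarrow> nat \<Rightarrow> real) \<Rightarrow> (nat \<Rightarrow> real) \<Rightarrow> (real^'n^'n \<Rightarrow> real) \<Rightarrow>
   real^'n^'n \<Rightarrow> (nat \<Rightarrow> real^'n^'n) \<Rightarrow> (nat \<Rightarrow> real^'n^'n) \<Rightarrow> (nat \<Rightarrow> real^'n^'n) \<Rightarrow>
   real^'n^'n \<Rightarrow> real^'n^'n \<Rightarrow> real^'n^'n \<Rightarrow> bool" where
  "reduced_integrator s h a b hred f0 \<Theta> \<mu> \<Omega> \<Lambda> p0 p1 \<longleftrightarrow>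
     (let A = (\<lambda>i. reduced_point s h (a i) f0 \<Theta> \<Omega>);
          Y = (\<lambda>i. Asym (\<Theta> i ** \<Lambda> ** transpose (\<Omega> i)))
      in
      (\<forall>k\<in>{1..s}. \<mu> k = - Asym (\<Theta> k ** \<Lambda>)
         - h *\<^sub>R (\<Sum>i=1..s. (b i / b k) *\<^sub>R T_map s h a A \<Theta> \<Omega> i k (Y i))) \<and>
      0 = Asym (reduced_point s h b f0 \<Theta> \<Omega>) \<and>
      (\<forall>i\<in>{1..s}. transpose (\<Theta> i) = polar (A i)) \<and>
      Asym (f0 ** \<Lambda>) = - p0 - h *\<^sub>R (\<Sum>i=1..s. b i *\<^sub>R R_map s h a A \<Theta> \<Omega> f0 i (Y i)) \<and>
      p1 = Asym (reduced_point s h b f0 \<Theta> \<Omega> ** transpose \<Lambda>) \<and>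
      (\<forall>i\<in>{1..s}. \<Omega> i = skew_grad hred (\<mu> i)))"

end

theory Submission
  imports Defs
begin

text \<open>
  Everything rests on the equivariance \<open>polar (g A) = g polar A\<close> and its derivative
  \<open>dpolar (g A) (g B) = dpolar A B\<close>. The first gives (A). For (B), left multiplication by \<open>g\<^sub>1\<^sup>T\<close>
  carries the stage points \<open>A\<^sub>i\<close> to the reduced ones, and the linear system for \<open>(S\<^sub>1, \<dots>, S\<^sub>s)\<close> is
  the adjoint of \<open>\<phi>\<close>. Hence \<open>\<langle>\<pi>\<^sub>i \<phi>\<inverse> Y, S\<rangle> = \<langle>Y, (S\<^sub>1, \<dots>, S\<^sub>s)\<rangle>\<close> for all \<open>Y\<close>, which for the two choices
  of \<open>Y\<close> in the unreduced equations identifies the adjoints there with \<open>T\<^sub>i\<^sub>k\<close> and \<open>R\<^sub>i\<close>. For \<open>V\<close>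
  take the matrices with positive definite symmetric part: there \<open>polar M = I\<close> just means that \<open>M\<close> is
  symmetric. The derivative of \<open>H\<close> along the group vanishes since \<open>H\<close> does not depend on \<open>U\<close>.
\<close>

section \<open>Matrices\<close>

lemma bounded_bilinear_matrix_mult:
  "bounded_bilinear ((**) :: real^'n^'n \<Rightarrow> real^'n^'n \<Rightarrow> real^'n^'n)"
  unfolding bilinear_conv_bounded_bilinear[symmetric] bilinear_def linear_iff
  by (intro conjI allI)
     (simp_all add: vec_eq_iff matrix_matrix_mult_def sum.distrib distrib_left distrib_right
        sum_distrib_left ac_simps)

interpretation matrix_mult: bounded_bilinear "(**) :: real^'n^'n \<Rightarrow> real^'n^'n \<Rightarrow> real^'n^'n"
  by (rule bounded_bilinear_matrix_mult)

lemma transpose_add: "transpose (A + B) = transpose A + transpose (B :: real^'n^'n)"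
  and transpose_diff: "transpose (A - B) = transpose A - transpose (B :: real^'n^'n)"
  and transpose_minus: "transpose (- A) = - transpose (A :: real^'n^'n)"
  and transpose_zero: "transpose (0 :: real^'n^'n) = 0"
  by (simp_all add: vec_eq_iff transpose_def)

lemma bounded_linear_transpose: "bounded_linear (transpose :: real^'n^'n \<Rightarrow> real^'n^'n)"
  by (simp add: linear_conv_bounded_linear[symmetric] linear_iff transpose_add transpose_scalar)

text \<open>Cyclicity of the trace. Together with \<open>inner_matrix_right\<close> it moves factors
  across the inner product whenever an adjoint is computed.\<close>

lemma inner_matrix_left:
  fixes A B C :: "real^'n^'n"
  shows "(A ** B) \<bullet> C = B \<bullet> (transpose A ** C)"
proof -
  have "(A ** B) \<bullet> C = trace (A ** (B ** transpose C))"
    by (simp only: matrix_inner_eq_trace matrix_mul_assoc)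
  also have "\<dots> = trace ((B ** transpose C) ** A)" by (rule trace_mul_sym)
  also have "\<dots> = B \<bullet> (transpose A ** C)"
    by (simp only: matrix_inner_eq_trace matrix_transpose_mul transpose_transpose matrix_mul_assoc)
  finally show ?thesis .
qed

lemma inner_transpose:
  fixes A B :: "real^'n^'n"
  shows "transpose A \<bullet> transpose B = A \<bullet> B"
  by (simp only: matrix_inner_eq_trace transpose_transpose trace_mul_sym[of "transpose A"])
     (simp only: matrix_inner_eq_trace[symmetric] inner_commute)

lemma inner_matrix_right:
  fixes A B C :: "real^'n^'n"
  shows "(A ** B) \<bullet> C = A \<bullet> (C ** transpose B)"
proof -
  have "(A ** B) \<bullet> C = (transpose B ** transpose A) \<bullet> transpose C"
    by (simp only: inner_transpose matrix_transpose_mul[symmetric])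
  also have "\<dots> = transpose A \<bullet> transpose (C ** transpose B)"
    by (simp only: inner_matrix_left matrix_transpose_mul)
  finally show ?thesis by (simp only: inner_transpose)
qed

lemma continuous_on_det [continuous_intros]:
  "continuous_on S f \<Longrightarrow> continuous_on S (\<lambda>x. det (f x :: real^'n^'n))"
  unfolding det_def by (intro continuous_intros)

section \<open>Rotations, skew matrices and the halved inner product\<close>

lemma SO_iff: "U \<in> SO \<longleftrightarrow> transpose U ** U = mat 1 \<and> 0 < det U"
  using det_orthogonal_matrix[of U] by (auto simp: SO_def rotation_matrix_def orthogonal_matrix)

lemma SO_D:
  assumes "U \<in> SO"
  shows "transpose U ** U = mat 1" "U ** transpose U = mat 1" "det U = 1"
  using assms by (auto simp: SO_def rotation_matrix_def orthogonal_matrix_def)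

lemma SO_mult: "U \<in> SO \<Longrightarrow> W \<in> SO \<Longrightarrow> U ** W \<in> SO"
  by (simp add: SO_def rotation_matrix_def orthogonal_matrix_mul det_mul)

lemma SO_transpose: "U \<in> SO \<Longrightarrow> transpose U \<in> SO"
  by (simp add: SO_def rotation_matrix_def)

lemma SO_one: "mat 1 \<in> SO"
  by (simp add: SO_iff)

lemma SO_cancel:
  assumes "U \<in> SO"
  shows "transpose U ** (U ** A) = A" "U ** (transpose U ** A) = A"
  using SO_D[OF assms] by (simp_all add: matrix_mul_assoc)

lemma Skew_iff: "A \<in> Skew \<longleftrightarrow> transpose A = - A"
  by (simp add: Skew_def)

lemma subspace_Skew: "subspace Skew"
  by (auto simp: subspace_def Skew_iff transpose_add transpose_scalar transpose_zero)

lemma Asym_in_Skew: "Asym A \<in> Skew"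
  by (simp add: Asym_def Skew_iff transpose_diff)

lemma Asym_Skew: "A \<in> Skew \<Longrightarrow> Asym A = 2 *\<^sub>R A"
  by (simp add: Asym_def Skew_iff scaleR_2)

lemma linear_Asym: "linear Asym"
  by (simp add: linear_iff Asym_def transpose_add transpose_scalar scaleR_diff_right)

lemma skew_inner_eq_inner: "skew_inner X Y = (X \<bullet> Y) / 2"
  by (simp add: skew_inner_def matrix_inner_eq_trace)

text \<open>For skew \<open>X\<close> the two terms of \<open>X \<bullet> Asym M\<close> are equal,
  and the half in \<open>skew_inner\<close> absorbs the factor two. This is why \<open>Asym\<close>
  appears whenever an adjoint lands in \<open>Skew\<close>.\<close>

lemma skew_inner_Asym_right:
  assumes "X \<in> Skew" shows "skew_inner X (Asym M) = X \<bullet> M"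
  using inner_transpose[of X M] assms
  by (simp add: skew_inner_eq_inner Asym_def inner_diff_right Skew_iff)

lemma skew_inner_eqI:
  assumes "v \<in> Skew" "w \<in> Skew" "\<And>x. x \<in> Skew \<Longrightarrow> skew_inner v x = skew_inner w x"
  shows "v = w"
  using assms(3)[of "v - w"] subspace_diff[OF subspace_Skew assms(1,2)]
  by (simp add: skew_inner_eq_inner) (metis eq_iff_diff_eq_0 inner_diff_left inner_eq_zero_iff)

section \<open>Positive definite matrices and the Sylvester equation\<close>

lemma bounded_bilinear_matrix_vector:
  "bounded_bilinear ((*v) :: real^'n^'n \<Rightarrow> real^'n \<Rightarrow> real^'n)"
  unfolding bilinear_conv_bounded_bilinear[symmetric] bilinear_def linear_iff
  by (intro conjI allI)
     (simp_all add: vec_eq_iff matrix_vector_mult_def sum.distrib distrib_left distrib_right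
        sum_distrib_left ac_simps)

interpretation matrix_vector: bounded_bilinear "(*v) :: real^'n^'n \<Rightarrow> real^'n \<Rightarrow> real^'n"
  by (rule bounded_bilinear_matrix_vector)

text \<open>The quadratic form has a positive minimum on the unit sphere, so small perturbations
  keep it positive. \<open>pos_def\<close> does not demand symmetry, so the set can serve as a
  neighbourhood in the space of all matrices.\<close>

lemma open_pos_def: "open {P :: real^'n^'n. pos_def P}"
  unfolding open_contains_ball
proof safe
  fix P :: "real^'n^'n"
  assume P: "pos_def P"
  obtain K where K: "0 < K" "\<And>(A::real^'n^'n) x. norm (A *v x) \<le> norm A * norm x * K"
    using matrix_vector.pos_bounded by blast
  have "continuous_on (sphere 0 1) (\<lambda>x. x \<bullet> (P *v x))"
    by (intro continuous_intros matrix_vector.continuous_on)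
  then obtain u where u: "u \<in> sphere 0 1" "\<And>x. x \<in> sphere 0 1 \<Longrightarrow> u \<bullet> (P *v u) \<le> x \<bullet> (P *v x)"
    using continuous_attains_inf[of "sphere (0::real^'n) 1"] by force
  define c where "c = u \<bullet> (P *v u)"
  have "u \<noteq> 0" using u(1) by auto
  then have c: "0 < c" using P by (simp add: c_def pos_def_def)
  \<comment> \<open>By the choice of \<open>K\<close>, this radius changes the form by less than its
    minimum \<open>c\<close> on unit vectors.\<close>
  have "pos_def Q" if Q: "Q \<in> ball P (c / K)" for Q
    unfolding pos_def_def
  proof (intro allI impI)
    fix x :: "real^'n" assume "x \<noteq> 0"
    define y where "y = (1 / norm x) *\<^sub>R x"
    have y: "norm y = 1" using \<open>x \<noteq> 0\<close> by (simp add: y_def)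
    have "\<bar>y \<bullet> ((Q - P) *v y)\<bar> \<le> norm ((Q - P) *v y)"
      using Cauchy_Schwarz_ineq2[of y] y by simp
    also have "\<dots> \<le> norm (Q - P) * K" using K(2)[of "Q - P" y] y by simp
    also have "\<dots> < c" using Q K(1) by (simp add: dist_norm norm_minus_commute field_simps)
    finally have "\<bar>y \<bullet> ((Q - P) *v y)\<bar> < c" .
    moreover have "c \<le> y \<bullet> (P *v y)" using u(2)[of y] y by (simp add: c_def)
    ultimately have "0 < y \<bullet> (Q *v y)"
      by (simp add: matrix_vector.diff_left inner_diff_right)
    moreover have "x = norm x *\<^sub>R y" using \<open>x \<noteq> 0\<close> by (simp add: y_def)
    then have "x \<bullet> (Q *v x) = norm x * norm x * (y \<bullet> (Q *v y))"
      by (metis inner_scaleR_left inner_scaleR_right matrix_vector.scaleR_right mult.assoc)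
    ultimately show "0 < x \<bullet> (Q *v x)" using \<open>x \<noteq> 0\<close> by simp
  qed
  then show "\<exists>e>0. ball P e \<subseteq> {P. pos_def P}"
    using c K(1) by (intro exI[of _ "c / K"]) auto
qed

lemma pos_def_one: "pos_def (mat 1)"
  by (simp add: pos_def_def)

lemma inner_matrix_columns: "(A :: real^'n^'n) \<bullet> B = (\<Sum>j\<in>UNIV. column j A \<bullet> column j (B :: real^'n^'n))"
  by (simp add: inner_vec_def column_def) (rule sum.swap)

lemma column_matrix_mult: "column j ((A :: real^'n^'n) ** B) = A *v column j (B :: real^'n^'n)"
  by (simp add: vec_eq_iff column_def matrix_matrix_mult_def matrix_vector_mult_def)

text \<open>The pairing is the sum of the quadratic form of \<open>P\<close> over the columns of
  \<open>X\<close>.\<close>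

lemma pos_def_inner_pos:
  assumes "pos_def P" "X \<noteq> (0 :: real^'n^'n)"
  shows "0 < X \<bullet> (P ** X)"
proof -
  obtain j where "column j X \<noteq> 0"
    using assms(2) by (auto simp: vec_eq_iff column_def)
  moreover have "0 \<le> column i X \<bullet> (P *v column i X)" for i
    using assms(1) unfolding pos_def_def by (metis inner_zero_left less_eq_real_def)
  ultimately show ?thesis
    using assms(1) unfolding inner_matrix_columns column_matrix_mult pos_def_def
    by (intro sum_pos2[where i = j]) auto
qed

lemma pos_def_transpose: "pos_def P \<Longrightarrow> pos_def (transpose P)"
  unfolding pos_def_def by (metis dot_lmul_matrix inner_commute transpose_matrix_vector)

text \<open>Pairing the equation with \<open>X\<close> makes both terms positive unless
  \<open>X = 0\<close>. This yields the uniqueness of the polar factors and the injectivity of the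
  derivative in \<open>polar_differentiable\<close>.\<close>

lemma Sylvester_injective:
  assumes "pos_def P" "pos_def Q" "P ** X + X ** Q = (0 :: real^'n^'n)"
  shows "X = 0"
proof (rule ccontr)
  assume X: "X \<noteq> 0"
  have "X \<bullet> (X ** Q) = transpose X \<bullet> (transpose Q ** transpose X)"
    by (metis inner_transpose matrix_transpose_mul)
  then have "0 < X \<bullet> (X ** Q)"
    using pos_def_inner_pos[OF pos_def_transpose[OF assms(2)], of "transpose X"] X
    by (metis transpose_transpose transpose_zero)
  moreover have "0 < X \<bullet> (P ** X)" by (rule pos_def_inner_pos[OF assms(1) X])
  ultimately show False
    using assms(3) by (metis add_pos_pos inner_add_right inner_zero_right less_irrefl)
qed

section \<open>The polar decomposition\<close>

lemma pos_def_cancel: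
  assumes "pos_def P" "X ** P = (0 :: real^'n^'n)"
  shows "X = 0"
proof -
  have "transpose P ** transpose X = 0"
    by (metis assms(2) matrix_transpose_mul transpose_zero)
  then have "transpose X = 0"
    using pos_def_inner_pos[OF pos_def_transpose[OF assms(1)], of "transpose X"] by fastforce
  then show ?thesis by (metis transpose_transpose transpose_zero)
qed

text \<open>As \<open>M\<close> may be non-symmetric, the argument is by continuity: the segment
  from the identity to \<open>M\<close> stays positive definite, so the determinant never vanishes
  on it and keeps its sign.\<close>

lemma pos_def_det:
  fixes M :: "real^'n^'n"
  assumes "pos_def M"
  shows "0 < det M"
proof (rule ccontr)
  have nz: "det N \<noteq> 0" if "pos_def N" for N :: "real^'n^'n"
  proof
    assume "det N = 0"
    then obtain x where "x \<noteq> 0" "N *v x = 0"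
      by (metis invertible_det_nz invertible_def matrix_left_invertible_ker matrix_left_right_inverse)
    then show False using that by (metis inner_zero_right less_irrefl pos_def_def)
  qed
  define f where "f t = det ((1 - t) *\<^sub>R mat 1 + t *\<^sub>R M)" for t
  assume "\<not> 0 < det M"
  then have "f 1 \<le> 0" "0 \<le> f 0" by (simp_all add: f_def)
  moreover have "continuous_on {0..1} f"
    unfolding f_def by (intro continuous_intros)
  ultimately obtain t where t: "0 \<le> t" "t \<le> 1" "f t = 0"
    using IVT2'[of f 1 0 0] by auto
  have "pos_def ((1 - t) *\<^sub>R mat 1 + t *\<^sub>R M)"
    unfolding pos_def_def
  proof (intro allI impI)
    fix x :: "real^'n" assume "x \<noteq> 0"
    then have "0 < x \<bullet> x" "0 < x \<bullet> (M *v x)" using assms by (auto simp: pos_def_def)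
    then have "0 < (1 - t) * (x \<bullet> x) + t * (x \<bullet> (M *v x))"
      using t by (cases "t = 0") (auto intro: add_nonneg_pos)
    then show "0 < x \<bullet> (((1 - t) *\<^sub>R mat 1 + t *\<^sub>R M) *v x)"
      by (simp add: matrix_vector.add_left matrix_vector.scaleR_left inner_add_right)
  qed
  then show False using nz t(3) by (auto simp: f_def)
qed

text \<open>\<open>P\<close> and \<open>Q\<close> have the same square, and P(P-Q) + (P-Q)Q = PP -
  QQ is a Sylvester expression in P-Q.\<close>

lemma polar_decomposition_unique:
  fixes P Q :: "real^'n^'n"
  assumes "U \<in> SO" "transpose P = P" "pos_def P"
    and "W \<in> SO" "transpose Q = Q" "pos_def Q"
    and "U ** P = W ** Q"
  shows "U = W"
proof -
  have sq: "transpose (V ** R) ** (V ** R) = R ** R" if "V \<in> SO" "transpose R = R" for V R :: "real^'n^'n"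
    by (simp add: matrix_transpose_mul that(2) matrix_mul_assoc[symmetric] SO_cancel(1)[OF that(1)])
  have "P ** P = Q ** Q"
    using sq[OF assms(1,2)] sq[OF assms(4,5)] assms(7) by simp
  then have "P ** (P - Q) + (P - Q) ** Q = 0"
    by (simp add: matrix_mult.diff_left matrix_mult.diff_right)
  then have "P = Q"
    using Sylvester_injective[OF assms(3,6), of "P - Q"] by simp
  then have "(U - W) ** P = 0" using assms(7) by (simp add: matrix_mult.diff_left)
  then show ?thesis using pos_def_cancel[OF assms(3), of "U - W"] by simp
qed

lemma polar_eqI:
  assumes "U \<in> SO" "transpose P = P" "pos_def P" "A = U ** P"
  shows "polar A = U"
  unfolding polar_def using assms polar_decomposition_unique by (intro the_equality) blast+

section \<open>Existence of the polar decomposition by maximizing a trace\<close>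

lemma linear_le_quadratic_imp_zero:
  fixes d K :: real
  assumes "\<And>t. t * d \<le> t\<^sup>2 * K"
  shows "d = 0"
proof -
  \<comment> \<open>Any positive \<open>c\<close> above \<open>K\<close> works: at t = d/c the
    inequality says that c times the square of d is at most K times that square.\<close>
  define c where "c = \<bar>K\<bar> + 1"
  have c: "0 < c" "K < c" by (simp_all add: c_def)
  have "d / c * d * c\<^sup>2 \<le> (d / c)\<^sup>2 * K * c\<^sup>2"
    using assms[of "d / c"] by (intro mult_right_mono) auto
  then have "d\<^sup>2 * c \<le> d\<^sup>2 * K" using c(1) by (simp add: power2_eq_square field_simps)
  then show ?thesis using c by (metis mult_le_cancel_left_pos not_less zero_less_power2)
qed

lemma compact_orthogonal: "compact {U :: real^'n^'n. transpose U ** U = mat 1}"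
  unfolding compact_eq_bounded_closed
proof
  have "norm U \<le> sqrt (norm (mat 1 :: real^'n^'n) * norm (mat 1 :: real^'n^'n))"
    if "transpose U ** U = mat 1" for U :: "real^'n^'n"
  proof -
    have "U \<bullet> U = mat 1 \<bullet> (mat 1 :: real^'n^'n)"
      using inner_matrix_left[of U "mat 1" U] that by simp
    then show ?thesis by (simp add: norm_eq_sqrt_inner)
  qed
  then show "bounded {U :: real^'n^'n. transpose U ** U = mat 1}"
    unfolding bounded_iff by blast
  have "continuous_on UNIV (\<lambda>U :: real^'n^'n. transpose U ** U)"
    by (intro matrix_mult.continuous_on linear_continuous_on bounded_linear_transpose
        continuous_on_id)
  then have "closed ((\<lambda>U :: real^'n^'n. transpose U ** U) -` {mat 1})"
    by (rule closed_vimage[OF closed_singleton])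
  then show "closed {U :: real^'n^'n. transpose U ** U = mat 1}"
    by (simp add: vimage_def)
qed

lemma matrix_inner_eq_sum_axis:
  fixes M :: "real^'n^'n"
  shows "matrix f \<bullet> M = (\<Sum>j\<in>UNIV. f (axis j 1) \<bullet> (M *v axis j 1))"
  by (simp add: inner_matrix_columns matrix_def column_def matrix_vector_mult_basis)

text \<open>This is the pairing of \<open>M\<close> with the rank-one map that sends x to (x . u) w.
  Reflections and their products differ from the identity by combinations of such maps.\<close>

lemma sum_axis_inner:
  fixes M :: "real^'n^'n"
  shows "(\<Sum>j\<in>UNIV. (axis j 1 \<bullet> u) * (w \<bullet> (M *v axis j 1))) = w \<bullet> (M *v u)"
proof -
  have "M *v u = M *v (\<Sum>j\<in>UNIV. (axis j 1 \<bullet> u) *\<^sub>R axis j 1)"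
    by (simp add: inner_axis' basis_expansion scalar_mult_eq_scaleR[symmetric])
  then show ?thesis
    by (simp add: matrix_vector.sum_right matrix_vector.scaleR_right inner_sum_right)
qed

text \<open>The reflection in the hyperplane orthogonal to \<open>v\<close>; the identity when
  \<open>v = 0\<close>.\<close>

definition householder :: "real^'n \<Rightarrow> real^'n \<Rightarrow> real^'n" where
  "householder v x = x - (2 * (x \<bullet> v) / (v \<bullet> v)) *\<^sub>R v"

lemma orthogonal_transformation_householder: "orthogonal_transformation (householder v)"
proof (cases "v = 0")
  case True
  then show ?thesis by (simp add: orthogonal_transformation_def linear_iff householder_def)
next
  case False
  then show ?thesis
    by (simp add: orthogonal_transformation_def linear_iff householder_def algebra_simps
        add_divide_distrib inner_diff_left inner_diff_right inner_commute)
qed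

text \<open>Taking for \<open>Q\<close> a reflection shows that \<open>M\<close> is positive semidefinite, and a product
  of two nearby reflections, a small rotation, shows that \<open>M\<close> is symmetric.\<close>

lemma trace_maximal_imp_symmetric_psd:
  fixes M :: "real^'n^'n"
  assumes "\<And>Q. transpose Q ** Q = mat 1 \<Longrightarrow> Q \<bullet> M \<le> mat 1 \<bullet> M"
  shows "transpose M = M" "0 \<le> x \<bullet> (M *v x)"
proof -
  let ?R = "householder :: real^'n \<Rightarrow> real^'n \<Rightarrow> real^'n"
  have orth: "matrix f \<bullet> M \<le> mat 1 \<bullet> M" if "orthogonal_transformation f" for f :: "real^'n \<Rightarrow> real^'n"
    using that by (intro assms) (metis orthogonal_transformation_matrix orthogonal_matrix)
  have one: "(\<Sum>j\<in>UNIV. axis j 1 \<bullet> (M *v axis j 1)) = mat 1 \<bullet> M"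
    using matrix_inner_eq_sum_axis[of id M] by (simp add: matrix_id_mat_1)
  have psd: "0 \<le> x \<bullet> (M *v x)" for x
  proof (cases "x = 0")
    case False
    have "matrix (?R x) \<bullet> M = mat 1 \<bullet> M - 2 / (x \<bullet> x) * (x \<bullet> (M *v x))"
      unfolding matrix_inner_eq_sum_axis householder_def
      by (simp add: inner_diff_left sum_subtractf one sum_axis_inner[symmetric, where u = x and w = x]
          sum_distrib_left mult.assoc)
    then have "0 \<le> 2 / (x \<bullet> x) * (x \<bullet> (M *v x))"
      using orth[OF orthogonal_transformation_householder, of x] by simp
    then show ?thesis using False by (simp add: zero_le_divide_iff zero_le_mult_iff)
         (metis inner_gt_zero_iff not_less)
  qed simp
  show "0 \<le> x \<bullet> (M *v x)" by (rule psd)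
  \<comment> \<open>Maximality against the product of the reflections in \<open>u\<close> and
    \<open>v\<close>, with the denominators cleared.\<close>
  have two: "2 * (u \<bullet> v) * (v \<bullet> (M *v u)) \<le> (v \<bullet> v) * (u \<bullet> (M *v u)) + (u \<bullet> u) * (v \<bullet> (M *v v))"
    for u v :: "real^'n"
  proof (cases "u = 0 \<or> v = 0")
    case False
    then have p: "0 < u \<bullet> u" "0 < v \<bullet> v" by auto
    let ?c = "2 / (u \<bullet> u)" and ?d = "2 / (v \<bullet> v)"
    have RR: "?R v (?R u x) = x - (?c * (x \<bullet> u)) *\<^sub>R u - (?d * (x \<bullet> v)) *\<^sub>R v
        + (?d * ?c * (u \<bullet> v) * (x \<bullet> u)) *\<^sub>R v" for x
      by (simp add: householder_def inner_diff_left algebra_simps diff_divide_distrib)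
    have "matrix (?R v \<circ> ?R u) \<bullet> M = mat 1 \<bullet> M - ?c * (u \<bullet> (M *v u)) - ?d * (v \<bullet> (M *v v))
        + ?d * ?c * (u \<bullet> v) * (v \<bullet> (M *v u))"
      unfolding matrix_inner_eq_sum_axis o_def RR inner_diff_left inner_add_left sum_subtractf
        sum.distrib inner_scaleR_left one mult.assoc sum_distrib_left[symmetric] sum_axis_inner ..
    then have "?d * ?c * (u \<bullet> v) * (v \<bullet> (M *v u)) \<le> ?c * (u \<bullet> (M *v u)) + ?d * (v \<bullet> (M *v v))"
      using orth[OF orthogonal_transformation_compose[OF orthogonal_transformation_householder
          orthogonal_transformation_householder], of v u] by simp
    then have "?d * ?c * (u \<bullet> v) * (v \<bullet> (M *v u)) * ((u \<bullet> u) * (v \<bullet> v) / 2)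
      \<le> (?c * (u \<bullet> (M *v u)) + ?d * (v \<bullet> (M *v v))) * ((u \<bullet> u) * (v \<bullet> v) / 2)"
      using p by (intro mult_right_mono) auto
    then show ?thesis using p False by (simp add: field_simps)
  qed auto
  have "axis j 1 \<bullet> (M *v axis i 1) = axis i 1 \<bullet> (M *v axis j 1)" for i j
  proof (cases "i = j")
    case False
    let ?u = "axis i 1 :: real^'n" and ?w = "axis j 1 :: real^'n"
    have o: "?u \<bullet> ?u = 1" "?w \<bullet> ?w = 1" "?u \<bullet> ?w = 0" "?w \<bullet> ?u = 0"
      using False by (auto simp: inner_axis_axis)
    \<comment> \<open>In \<open>two\<close> with v = u + t w, the terms linear in \<open>t\<close>
      are the antisymmetric part of \<open>M\<close> at the entries i, j.\<close>
    have "t * (?w \<bullet> (M *v ?u) - ?u \<bullet> (M *v ?w)) \<le> t\<^sup>2 * (?u \<bullet> (M *v ?u) + ?w \<bullet> (M *v ?w))" for t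
      using two[of ?u "?u + t *\<^sub>R ?w"]
      unfolding matrix_vector.add_right matrix_vector.scaleR_right inner_add_left inner_add_right
        inner_scaleR_left inner_scaleR_right o
      by (simp add: algebra_simps power2_eq_square)
    from linear_le_quadratic_imp_zero[OF this] show ?thesis by simp
  qed simp
  then show "transpose M = M"
    by (simp add: vec_eq_iff transpose_def matrix_vector_mult_basis inner_axis' column_def)
qed

text \<open>Let \<open>U\<close> maximize the pairing with \<open>A\<close> over the compact set of
  orthogonal matrices. Then M = U^T A is maximal at the identity, hence symmetric and semidefinite;
  invertibility makes it definite, and only then does the sign of det A put \<open>U\<close> in
  \<open>SO\<close>.\<close>

lemma polar_decomposition_exists:
  fixes A :: "real^'n^'n"
  assumes "0 < det A"
  obtains U P where "U \<in> SO" "transpose P = P" "pos_def P" "A = U ** P"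
proof -
  let ?K = "{U :: real^'n^'n. transpose U ** U = mat 1}"
  have "continuous_on ?K (\<lambda>U. U \<bullet> A)" by (intro continuous_intros)
  moreover have "mat 1 \<in> ?K" by simp
  then have "?K \<noteq> {}" by blast
  ultimately have "\<exists>U\<in>?K. \<forall>W\<in>?K. W \<bullet> A \<le> U \<bullet> A"
    by (rule continuous_attains_sup[OF compact_orthogonal, rotated])
  then obtain U where U: "U \<in> ?K" "\<And>W. W \<in> ?K \<Longrightarrow> W \<bullet> A \<le> U \<bullet> A"
    by blast
  then have orth: "orthogonal_matrix U" by (simp add: orthogonal_matrix)
  define M where "M = transpose U ** A"
  have A: "A = U ** M"
    using orth by (simp add: M_def matrix_mul_assoc orthogonal_matrix_def)
  have "Q \<bullet> M \<le> mat 1 \<bullet> M" if "transpose Q ** Q = mat 1" for Q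
  proof -
    have "orthogonal_matrix (U ** Q)"
      using that orthogonal_matrix by (intro orthogonal_matrix_mul orth) blast
    then have "U ** Q \<in> ?K" by (simp add: orthogonal_matrix)
    then have "(U ** Q) \<bullet> A \<le> (U ** mat 1) \<bullet> A" using U(2) by simp
    then show ?thesis by (simp only: inner_matrix_left M_def)
  qed
  note M = trace_maximal_imp_symmetric_psd[OF this]
  have "det U \<noteq> 0" using det_orthogonal_matrix[OF orth] by auto
  then have "invertible M"
    using assms \<open>det U \<noteq> 0\<close> by (simp add: invertible_det_nz M_def det_mul)
  have "pos_def M"
    unfolding pos_def_def
  proof (intro allI impI, rule ccontr)
    fix x :: "real^'n" assume x: "x \<noteq> 0" "\<not> 0 < x \<bullet> (M *v x)"
    then have z: "x \<bullet> (M *v x) = 0" using M(2)[of x] by simp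
    let ?w = "M *v x"
    have s: "x \<bullet> (M *v ?w) = ?w \<bullet> ?w"
      by (metis M(1) dot_lmul_matrix transpose_matrix_vector)
    \<comment> \<open>Semidefiniteness at x + t M x: as the form vanishes at \<open>x\<close>, the
      linear term is a multiple of the squared norm of M x.\<close>
    have "t * (- 2 * (?w \<bullet> ?w)) \<le> t\<^sup>2 * (?w \<bullet> (M *v ?w))" for t
      using M(2)[of "x + t *\<^sub>R ?w"] z s
      by (simp add: matrix_vector.add_right matrix_vector.scaleR_right inner_add_left
          inner_add_right power2_eq_square algebra_simps)
    from linear_le_quadratic_imp_zero[OF this] have "M *v x = 0" by simp
    then show False
      using \<open>invertible M\<close> x(1)
      by (metis invertible_def matrix_left_invertible_ker)
  qed
  moreover have "0 < det U"
    using assms pos_def_det[OF \<open>pos_def M\<close>] A by (simp add: det_mul zero_less_mult_iff)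
  then have "U \<in> SO" using U(1) by (simp add: SO_iff)
  ultimately show ?thesis using that M(1) A by blast
qed

text \<open>Writing the positive factor as U^T A leaves \<open>polar A\<close> as the only unknown
  in later arguments.\<close>

lemma polar_decomposition:
  assumes "0 < det A"
  shows "polar A \<in> SO" "transpose (transpose (polar A) ** A) = transpose (polar A) ** A"
    "pos_def (transpose (polar A) ** A)"
proof -
  obtain U P where UP: "U \<in> SO" "transpose P = P" "pos_def P" "A = U ** P"
    using polar_decomposition_exists[OF assms] .
  then have "polar A = U" "transpose U ** A = P"
    using polar_eqI SO_cancel(1) by blast+
  then show "polar A \<in> SO" "transpose (transpose (polar A) ** A) = transpose (polar A) ** A"
    "pos_def (transpose (polar A) ** A)" using UP by simp_all
qed

text \<open>A rotation on the left changes only the orthogonal factor and keeps the positive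
  one.\<close>

lemma polar_mult_left:
  assumes "g \<in> SO" "0 < det A"
  shows "polar (g ** A) = g ** polar A"
proof (rule polar_eqI)
  show "g ** A = (g ** polar A) ** (transpose (polar A) ** A)"
    using polar_decomposition(1)[OF assms(2)] by (metis SO_cancel(2) matrix_mul_assoc)
qed (use assms polar_decomposition SO_mult in blast)+

text \<open>By uniqueness, A = I A is the polar decomposition exactly when \<open>A\<close> is
  symmetric. This turns the endpoint constraint into an \<open>Asym\<close> equation.\<close>

lemma polar_eq_one_iff:
  assumes "pos_def A"
  shows "polar A = mat 1 \<longleftrightarrow> Asym A = 0"
  using polar_decomposition(2)[OF pos_def_det[OF assms]] polar_eqI[OF SO_one _ assms, of A]
  by (auto simp: Asym_def)

section \<open>The derivative of the polar projection\<close>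

text \<open>The polar factors of \<open>A\<close> solve \<open>F (U, P) = (A, I)\<close> for the polynomial map
  \<open>F (U, P) = (U P, U\<^sup>T U + Asym P)\<close>, because the symmetric and the skew part of the second equation
  say that \<open>U\<close> is orthogonal and \<open>P\<close> symmetric. This makes the inverse function theorem applicable.\<close>

lemma polar_differentiable:
  fixes A :: "real^'n^'n"
  assumes "0 < det A"
  obtains D where "(polar has_derivative D) (at A)"
proof -
  let ?U = "polar A" and ?P = "transpose (polar A) ** A"
  \<comment> \<open>The determinant will single out rotations among orthogonal matrices. Symmetry of
    the second factor is left to the second component of \<open>F\<close>, so that \<open>S\<close>
    is open.\<close>
  define S :: "((real^'n^'n) \<times> (real^'n^'n)) set" where "S = {z. 0 < det (fst z) \<and> pos_def (snd z)}"
  define F :: "(real^'n^'n) \<times> (real^'n^'n) \<Rightarrow> (real^'n^'n) \<times> (real^'n^'n)"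
    where "F z = (fst z ** snd z, transpose (fst z) ** fst z + Asym (snd z))" for z
  define G :: "(real^'n^'n) \<times> (real^'n^'n) \<Rightarrow> (real^'n^'n) \<times> (real^'n^'n) \<Rightarrow> (real^'n^'n) \<times> (real^'n^'n)"
    where "G z w = (fst z ** snd w + fst w ** snd z,
      transpose (fst z) ** fst w + transpose (fst w) ** fst z + Asym (snd w))" for z w
  note polar = polar_decomposition[OF assms]
  have "S = (\<lambda>z. det (fst z)) -` {0<..} \<inter> snd -` {P. pos_def P}"
    by (auto simp: S_def)
  moreover have "open ((\<lambda>z :: (real^'n^'n) \<times> (real^'n^'n). det (fst z)) -` {0<..})"
    by (intro open_vimage continuous_intros open_greaterThan)
  moreover have "open ((snd :: (real^'n^'n) \<times> (real^'n^'n) \<Rightarrow> _) -` {P. pos_def P})"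
    by (intro open_vimage_snd open_pos_def)
  ultimately have "open S" by (metis open_Int)
  have bl: "bounded_linear (G z)" for z
    unfolding linear_conv_bounded_linear[symmetric]
    by (rule linearI) (simp_all add: G_def matrix_mult.add_left matrix_mult.add_right
      matrix_mult.scaleR_left matrix_mult.scaleR_right transpose_add transpose_scalar
      linear_add[OF linear_Asym] linear_scale[OF linear_Asym] scaleR_add_right)
  have bAsym: "bounded_linear (Asym :: real^'n^'n \<Rightarrow> _)"
    using linear_Asym by (simp add: linear_conv_bounded_linear)
  have der: "(F has_derivative G z) (at z)" for z
    unfolding F_def [abs_def] G_def [abs_def]
    by (intro has_derivative_Pair matrix_mult.FDERIV has_derivative_add
        bounded_linear.has_derivative[OF bounded_linear_transpose]
        bounded_linear.has_derivative[OF bAsym] has_derivative_fst has_derivative_snd has_derivative_ident)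
  \<comment> \<open>Continuity in operator norm is checked on each fixed direction, which suffices
    in finite dimension.\<close>
  have cont: "continuous_on S (\<lambda>z. Blinfun (G z))"
  proof (rule continuous_on_blinfun_componentwise)
    fix w :: "(real^'n^'n) \<times> (real^'n^'n)"
    show "continuous_on S (\<lambda>z. blinfun_apply (Blinfun (G z)) w)"
      unfolding bounded_linear_Blinfun_apply[OF bl] unfolding G_def
      by (intro continuous_intros matrix_mult.continuous_on
          bounded_linear.continuous_on[OF bounded_linear_transpose])
  qed
  have "det ?U = 1" using polar(1) SO_D(3) by blast
  then have "(?U, ?P) \<in> S"
    using polar(3) by (simp add: S_def)
  have "w = 0" if "G (?U, ?P) w = 0" for w
  proof -
    obtain X Q where w: "w = (X, Q)" by (cases w)
    \<comment> \<open>In the trivialized variable \<open>Y\<close>, the second component forces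
      \<open>Y\<close> skew and \<open>Q\<close> symmetric; the first then becomes PY + YP =
      0.\<close>
    define Y where "Y = transpose ?U ** X"
    have X: "X = ?U ** Y" by (simp add: Y_def SO_cancel(2)[OF polar(1)])
    have 1: "?U ** Q + X ** ?P = 0" and 2: "transpose ?U ** X + transpose X ** ?U + Asym Q = 0"
      using that by (simp_all add: G_def w zero_prod_def)
    have "Y + transpose Y + Asym Q = 0"
      using 2 by (simp add: Y_def matrix_transpose_mul)
    moreover from this have "transpose Y + Y + Asym (transpose Q) = 0"
      by (metis Asym_def transpose_add transpose_diff transpose_transpose transpose_zero)
    ultimately have s: "transpose Y = - Y" "transpose Q = Q"
      by (auto simp: Asym_def vec_eq_iff) (smt (verit))+
    have "transpose ?U ** (?U ** Q + ?U ** (Y ** ?P)) = 0"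
      using 1 X by (simp add: matrix_mul_assoc)
    then have 3: "Q + Y ** ?P = 0"
      by (simp add: matrix_mult.add_right SO_cancel(1)[OF polar(1)])
    then have "transpose (Q + Y ** ?P) = 0" by (simp add: transpose_zero)
    then have "Q - ?P ** Y = 0"
      by (simp only: transpose_add matrix_transpose_mul[of Y] s polar(2) matrix_mult.minus_right)
         simp
    with 3 have "?P ** Y + Y ** ?P = 0" by (simp add: algebra_simps)
    then have "Y = 0" using Sylvester_injective polar(3) by blast
    then show ?thesis using 3 X w by (simp add: zero_prod_def)
  qed
  then have "inj (G (?U, ?P))"
    using linear_injective_0[OF bounded_linear.linear[OF bl]] by blast
  then obtain H where H: "linear H" "H \<circ> G (?U, ?P) = id"
    using linear_injective_left_inverse[OF bounded_linear.linear[OF bl]] by blast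
  have "Blinfun H o\<^sub>L Blinfun (G (?U, ?P)) = id_blinfun"
    using H by (intro blinfun_eqI)
      (simp add: bounded_linear_Blinfun_apply bl linear_conv_bounded_linear pointfree_idE)
  moreover have "(F has_derivative blinfun_apply (Blinfun (G z))) (at z)" for z
    using der by (simp only: bounded_linear_Blinfun_apply[OF bl])
  ultimately
  obtain S' V g g' where SV: "open S'" "S' \<subseteq> S" "(?U, ?P) \<in> S'" "open V" "F (?U, ?P) \<in> V"
    "homeomorphism S' V F g" "\<And>y. y \<in> V \<Longrightarrow> (g has_derivative g' y) (at y)"
    using inverse_function_theorem[of S F "\<lambda>z. Blinfun (G z)" "(?U, ?P)" "Blinfun H"]
      \<open>open S\<close> cont \<open>(?U, ?P) \<in> S\<close> by metis
  have F0: "F (?U, ?P) = (A, mat 1)"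
    using SO_D(1)[OF polar(1)] polar(2) by (simp add: F_def SO_cancel(2)[OF polar(1)] Asym_def)
  \<comment> \<open>On the slice where the second target component is the identity, the local
    inverse \<open>g\<close> returns the polar factors.\<close>
  define W where "W = (\<lambda>B. (B, mat 1)) -` V"
  have "open W" "A \<in> W"
    using SV(4,5) F0 by (auto simp: W_def intro!: open_vimage continuous_intros)
  have eq: "fst (g (B, mat 1)) = polar B" if "B \<in> W" for B
  proof -
    obtain U P where z: "g (B, mat 1) = (U, P)" by (cases "g (B, mat 1)")
    have "(U, P) \<in> S'" "F (U, P) = (B, mat 1)"
      using SV(6) that z unfolding homeomorphism_def W_def by force+
    then have 1: "0 < det U" "pos_def P" "U ** P = B" "transpose U ** U + Asym P = mat 1"
      using SV(2) by (auto simp: S_def F_def)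
    have "transpose (transpose U ** U + Asym P) = mat 1" using 1(4) by simp
    then have "transpose U ** U - Asym P = mat 1"
      by (simp add: transpose_add matrix_transpose_mul Asym_def transpose_diff algebra_simps)
    moreover have "2 *\<^sub>R Asym P = (transpose U ** U + Asym P) - (transpose U ** U - Asym P)"
      by (simp add: scaleR_2)
    ultimately have "Asym P = 0" using 1(4) by simp
    moreover from this have "transpose U ** U = mat 1" using 1(4) by simp
    ultimately show ?thesis
      using 1(1-3) polar_eqI[of U P B] z by (auto simp: SO_iff Asym_def)
  qed
  have "((\<lambda>B. (B, mat 1 :: real^'n^'n)) has_derivative (\<lambda>B. (B, 0))) (at A)"
    by (intro has_derivative_Pair has_derivative_ident has_derivative_const)
  moreover have "(g has_derivative g' (A, mat 1)) (at (A, mat 1))"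
    using SV(5,7) F0 by simp
  ultimately have "((\<lambda>B. fst (g (B, mat 1))) has_derivative (\<lambda>B. fst (g' (A, mat 1) (B, 0)))) (at A)"
    by (intro has_derivative_fst) (rule has_derivative_compose)
  then have "(polar has_derivative (\<lambda>B. fst (g' (A, mat 1) (B, 0)))) (at A)"
    by (rule has_derivative_transform_within_open[OF _ \<open>open W\<close> \<open>A \<in> W\<close> eq])
  then show ?thesis using that by blast
qed

section \<open>The tangent map of the polar projection and its equivariance\<close>

lemma open_pos_det: "open {A :: real^'n^'n. 0 < det A}"
  using open_vimage[of "{0<..}" "\<lambda>A :: real^'n^'n. det A"]
  by (simp add: vimage_def continuous_on_det)

text \<open>Identities for \<open>polar\<close> are available only where the determinant is
  positive. That set is open, so they may still be differentiated there.\<close>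

lemma has_derivative_unique_pos_det:
  fixes f g :: "real^'n^'n \<Rightarrow> 'b::real_normed_vector"
  assumes "0 < det A" "(f has_derivative f') (at A)" "(g has_derivative g') (at A)"
    and "\<And>B. 0 < det B \<Longrightarrow> f B = g B"
  shows "f' = g'"
  using has_derivative_transform_within_open[OF assms(2) open_pos_det, of g] assms(1,3,4)
    has_derivative_unique by blast

text \<open>Obtained by differentiating U^T U = I.\<close>

lemma polar_derivative_Skew:
  assumes A: "0 < det A" and D: "(polar has_derivative D) (at A)"
  shows "transpose (polar A) ** D B \<in> Skew"
proof -
  have "((\<lambda>B. transpose (polar B) ** polar B) has_derivative
      (\<lambda>B. transpose (polar A) ** D B + transpose (D B) ** polar A)) (at A)"
    by (intro matrix_mult.FDERIV bounded_linear.has_derivative[OF bounded_linear_transpose] D)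
  then have "(\<lambda>B. transpose (polar A) ** D B + transpose (D B) ** polar A) = (\<lambda>B. 0)"
    by (rule has_derivative_unique_pos_det[OF A _ has_derivative_const])
       (use polar_decomposition(1) SO_D(1) in blast)
  then have "transpose (polar A) ** D B + transpose (D B) ** polar A = 0" by metis
  then show ?thesis
    by (simp add: Skew_iff matrix_transpose_mul add_eq_0_iff2 add.commute)
qed

text \<open>Links the definition through curves to the Frechet derivative: the chain rule gives the
  curve property.\<close>

lemma dpolar_eq:
  assumes A: "0 < det A" and D: "(polar has_derivative D) (at A)"
  shows "dpolar A B = transpose (polar A) ** D B"
  unfolding dpolar_def
proof (rule the_equality)
  have U: "polar A \<in> SO" by (rule polar_decomposition(1)[OF A])
  have curve: "((\<lambda>t. polar (\<gamma> t)) has_vector_derivative D B) (at 0)"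
    if "\<gamma> 0 = A" "(\<gamma> has_vector_derivative B) (at 0)" for \<gamma> :: "real \<Rightarrow> real^'a^'a"
    using has_derivative_compose[of \<gamma> "\<lambda>t. t *\<^sub>R B" 0 UNIV polar D] that D
    by (simp add: has_vector_derivative_def linear_scale[OF has_derivative_linear[OF D]])
  then show "transpose (polar A) ** D B \<in> Skew \<and>
     (\<forall>\<gamma> :: real \<Rightarrow> real^'a^'a. \<gamma> 0 = A \<and> (\<gamma> has_vector_derivative B) (at 0) \<longrightarrow>
        ((\<lambda>t. polar (\<gamma> t)) has_vector_derivative polar A ** (transpose (polar A) ** D B)) (at 0))"
    by (simp add: polar_derivative_Skew[OF A D] SO_cancel(2)[OF U])
  fix X
  assume X: "X \<in> Skew \<and>
     (\<forall>\<gamma> :: real \<Rightarrow> real^'a^'a. \<gamma> 0 = A \<and> (\<gamma> has_vector_derivative B) (at 0) \<longrightarrow>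
        ((\<lambda>t. polar (\<gamma> t)) has_vector_derivative polar A ** X) (at 0))"
  \<comment> \<open>The straight line is the test curve that determines \<open>X\<close>.\<close>
  have line: "((\<lambda>t. A + t *\<^sub>R B) has_vector_derivative B) (at 0)"
    by (auto intro!: derivative_eq_intros)
  have "polar A ** X = D B"
    using vector_derivative_unique_at[OF curve[OF _ line]]
      X[THEN conjunct2, rule_format, of "\<lambda>t. A + t *\<^sub>R B"] line by simp
  then show "X = transpose (polar A) ** D B"
    using SO_cancel(1)[OF U] by metis
qed

lemma dpolar_Skew: "0 < det A \<Longrightarrow> dpolar A B \<in> Skew"
  by (metis dpolar_eq polar_derivative_Skew polar_differentiable)

lemma linear_dpolar: "0 < det A \<Longrightarrow> linear (dpolar A)"
  by (metis (no_types, lifting) dpolar_eq ext polar_differentiable has_derivative_linear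
      linear_compose[unfolded o_def] bounded_linear.linear[OF matrix_mult.bounded_linear_right])

text \<open>Differentiates \<open>polar_mult_left\<close>; in the left trivialization the factor
  \<open>g\<close> cancels.\<close>

lemma dpolar_mult_left:
  assumes g: "g \<in> SO" and A: "0 < det A"
  shows "dpolar (g ** A) (g ** B) = dpolar A B"
proof -
  have det_g: "0 < det (g ** C)" if "0 < det C" for C
    using that SO_D(3)[OF g] by (simp add: det_mul)
  obtain D where D: "(polar has_derivative D) (at A)" using polar_differentiable[OF A] .
  obtain E where E: "(polar has_derivative E) (at (g ** A))"
    using polar_differentiable[OF det_g[OF A]] .
  have mult: "((**) g has_derivative (**) g) (at A)"
    by (rule bounded_linear.has_derivative[OF matrix_mult.bounded_linear_right has_derivative_ident])
  have "((\<lambda>C. polar (g ** C)) has_derivative (\<lambda>C. E (g ** C))) (at A)"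
    using has_derivative_compose[OF mult E] .
  moreover have "((\<lambda>C. g ** polar C) has_derivative (\<lambda>C. g ** D C)) (at A)"
    by (rule bounded_linear.has_derivative[OF matrix_mult.bounded_linear_right D])
  ultimately have "(\<lambda>C. E (g ** C)) = (\<lambda>C. g ** D C)"
    using has_derivative_unique_pos_det[OF A] polar_mult_left[OF g] by blast
  then have "E (g ** B) = g ** D B" by metis
  then show ?thesis
    by (simp add: dpolar_eq[OF A D] dpolar_eq[OF det_g[OF A] E] polar_mult_left[OF g A]
        matrix_transpose_mul matrix_mul_assoc[symmetric] SO_cancel(1)[OF g])
qed

lemma dpolar_adjoint:
  assumes "0 < det A"
  shows "B \<bullet> dpolar_adjoint A S = skew_inner (dpolar A B) S"
proof -
  \<comment> \<open>The half passes from the standard inner product behind \<open>adjoint\<close> to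
    \<open>skew_inner\<close>.\<close>
  define v where "v = adjoint (dpolar A) ((1/2) *\<^sub>R S)"
  have v: "skew_inner (dpolar A C) S = C \<bullet> v" for C
    using adjoint_works[OF linear_dpolar[OF assms], of C "(1/2) *\<^sub>R S"]
    by (simp add: v_def skew_inner_eq_inner)
  have "dpolar_adjoint A S = v"
    unfolding dpolar_adjoint_def adjoint_on_def
    by (rule the_equality) (auto simp: v vector_eq_ldot)
  then show ?thesis by (simp add: v)
qed

section \<open>Curves in \<open>SO\<close> and the left-trivialized derivative\<close>

lemma Skew_inner_zero:
  assumes "\<eta> \<in> Skew" shows "x \<bullet> (\<eta> *v x) = 0"
proof -
  have "x \<bullet> (\<eta> *v x) = (transpose \<eta> *v x) \<bullet> x" by (simp add: dot_lmul_matrix)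
  also have "\<dots> = - (x \<bullet> (\<eta> *v x))"
    using assms by (simp add: Skew_iff matrix_vector.minus_left inner_commute del: transpose_matrix_vector)
  finally show ?thesis by simp
qed

text \<open>Differentiating the symmetric factor \<open>transpose (polar A) ** A\<close> shows that
  \<eta> - D \<eta> is symmetric; it is also skew, hence zero.\<close>

lemma dpolar_one:
  assumes "\<eta> \<in> Skew" shows "dpolar (mat 1) \<eta> = \<eta>"
proof -
  have d1: "0 < det (mat 1 :: real^'a^'a)" by simp
  have p1: "polar (mat 1 :: real^'a^'a) = mat 1"
    by (simp add: polar_eq_one_iff pos_def_one Asym_def)
  obtain D where D: "(polar has_derivative D) (at (mat 1 :: real^'a^'a))"
    using polar_differentiable[OF d1] .
  have "((\<lambda>A. transpose (polar A) ** A) has_derivative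
      (\<lambda>B. transpose (polar (mat 1)) ** B + transpose (D B) ** mat 1)) (at (mat 1))"
    by (intro matrix_mult.FDERIV bounded_linear.has_derivative[OF bounded_linear_transpose] D
        has_derivative_ident)
  then have h: "((\<lambda>A. transpose (polar A) ** A) has_derivative (\<lambda>B. B + transpose (D B))) (at (mat 1))"
    by (simp add: p1)
  have "(\<lambda>B. transpose (B + transpose (D B))) = (\<lambda>B. B + transpose (D B))"
    by (rule has_derivative_unique_pos_det[OF d1
          bounded_linear.has_derivative[OF bounded_linear_transpose h] h])
       (rule polar_decomposition(2))
  then have "transpose (\<eta> + transpose (D \<eta>)) = \<eta> + transpose (D \<eta>)" by metis
  moreover have "D \<eta> \<in> Skew" using polar_derivative_Skew[OF d1 D, of \<eta>] by (simp add: p1)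
  ultimately have "2 *\<^sub>R (\<eta> - D \<eta>) = 0"
    using assms by (simp add: Skew_iff transpose_add transpose_minus scaleR_2 algebra_simps)
  then have "D \<eta> = \<eta>" by simp
  then show ?thesis by (simp add: dpolar_eq[OF d1 D] p1)
qed

text \<open>The polar projection of the line I + t \<eta> plays the role of the exponential. A skew
  matrix adds nothing to the quadratic form, so the line stays positive definite and the curve
  exists for all \<open>t\<close>, as \<open>left_grad\<close> demands.\<close>

lemma SO_curve_exists:
  assumes "U \<in> SO" "\<eta> \<in> Skew"
  obtains \<gamma> :: "real \<Rightarrow> real^'n^'n"
  where "\<And>t. \<gamma> t \<in> SO" "\<gamma> 0 = U" "(\<gamma> has_vector_derivative U ** \<eta>) (at 0)"
proof
  define \<gamma> where "\<gamma> t = U ** polar (mat 1 + t *\<^sub>R \<eta>)" for t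
  have "pos_def (mat 1 + t *\<^sub>R \<eta>)" for t
    using Skew_inner_zero[OF assms(2)]
    by (simp add: pos_def_def matrix_vector.add_left matrix_vector.scaleR_left inner_add_right)
  then show "\<gamma> t \<in> SO" for t
    unfolding \<gamma>_def by (intro SO_mult assms(1) polar_decomposition(1) pos_def_det)
  have p1: "polar (mat 1 :: real^'n^'n) = mat 1"
    by (simp add: polar_eq_one_iff pos_def_one Asym_def)
  then show "\<gamma> 0 = U" by (simp add: \<gamma>_def)
  obtain D where D: "(polar has_derivative D) (at (mat 1 :: real^'n^'n))"
    using polar_differentiable[of "mat 1 :: real^'n^'n"] by auto
  have "((\<lambda>t. mat 1 + t *\<^sub>R \<eta>) has_derivative (\<lambda>t. t *\<^sub>R \<eta>)) (at 0)"
    by (auto intro!: derivative_eq_intros)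
  then have "((\<lambda>t. polar (mat 1 + t *\<^sub>R \<eta>)) has_derivative (\<lambda>t. D (t *\<^sub>R \<eta>))) (at 0)"
    using has_derivative_compose[of "\<lambda>t. mat 1 + t *\<^sub>R \<eta>" "\<lambda>t. t *\<^sub>R \<eta>" 0 UNIV polar D] D by simp
  moreover have "D \<eta> = \<eta>"
    using dpolar_one[OF assms(2)] dpolar_eq[OF _ D, of \<eta>] by (simp add: p1)
  ultimately have "((\<lambda>t. polar (mat 1 + t *\<^sub>R \<eta>)) has_derivative (\<lambda>t. t *\<^sub>R \<eta>)) (at 0)"
    by (simp add: linear_scale[OF has_derivative_linear[OF D]])
  then show "(\<gamma> has_vector_derivative U ** \<eta>) (at 0)"
    using bounded_linear.has_derivative[OF matrix_mult.bounded_linear_right[of U]]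
    by (fastforce simp: \<gamma>_def [abs_def] has_vector_derivative_def matrix_mult.scaleR_right)
qed

text \<open>Uniqueness in the definite description needs a curve in every skew direction: a
  candidate \<open>G\<close> is tested along direction \<open>G\<close> itself.\<close>

lemma left_grad_constant:
  assumes "U \<in> SO" "\<And>V. V \<in> SO \<Longrightarrow> F V = c"
  shows "left_grad F U = 0"
  unfolding left_grad_def
proof (rule the_equality)
  have const: "(\<lambda>t. F (\<gamma> t)) = (\<lambda>t. c)" if "\<forall>t. \<gamma> t \<in> SO" for \<gamma> :: "real \<Rightarrow> real^'a^'a"
    using that assms(2) by auto
  show "0 \<in> Skew \<and> (\<forall>\<eta>\<in>Skew. \<forall>\<gamma>. (\<forall>t. \<gamma> t \<in> SO) \<and> \<gamma> 0 = U \<and>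
      (\<gamma> has_vector_derivative U ** \<eta>) (at 0) \<longrightarrow>
      ((\<lambda>t. F (\<gamma> t)) has_real_derivative skew_inner 0 \<eta>) (at 0))"
    by (simp add: const skew_inner_eq_inner subspace_0[OF subspace_Skew])
  fix G
  assume G: "G \<in> Skew \<and> (\<forall>\<eta>\<in>Skew. \<forall>\<gamma>. (\<forall>t. \<gamma> t \<in> SO) \<and> \<gamma> 0 = U \<and>
      (\<gamma> has_vector_derivative U ** \<eta>) (at 0) \<longrightarrow>
      ((\<lambda>t. F (\<gamma> t)) has_real_derivative skew_inner G \<eta>) (at 0))"
  then obtain \<gamma> :: "real \<Rightarrow> real^'a^'a"
    where \<gamma>: "\<And>t. \<gamma> t \<in> SO" "\<gamma> 0 = U" "(\<gamma> has_vector_derivative U ** G) (at 0)"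
    using SO_curve_exists[OF assms(1), of G] by blast
  then have "((\<lambda>t. F (\<gamma> t)) has_real_derivative skew_inner G G) (at 0)" using G by blast
  then have "skew_inner G G = 0"
    using const[of \<gamma>] \<gamma>(1) DERIV_unique[OF _ DERIV_const] by fastforce
  then show "G = 0" by (simp add: skew_inner_eq_inner)
qed

section \<open>The stage equations as an adjoint system\<close>

text \<open>The functional is linear only on \<open>Skew\<close>; precomposing with
  \<open>Asym\<close> extends it to all matrices, where \<open>adjoint\<close> applies.\<close>

lemma Riesz_Skew:
  fixes f :: "real^'n^'n \<Rightarrow> real"
  assumes "\<And>x y c d. x \<in> Skew \<Longrightarrow> y \<in> Skew \<Longrightarrow> f (c *\<^sub>R x + d *\<^sub>R y) = c * f x + d * f y"
  obtains v where "v \<in> Skew" "\<And>x. x \<in> Skew \<Longrightarrow> f x = skew_inner x v"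
proof -
  define F where "F x = f (Asym x)" for x
  have "linear F"
  proof (rule linearI)
    fix x y :: "real^'n^'n" and c :: real
    show "F (x + y) = F x + F y"
      using assms[OF Asym_in_Skew Asym_in_Skew, of 1 x 1 y]
      by (simp add: F_def linear_add[OF linear_Asym])
    show "F (c *\<^sub>R x) = c *\<^sub>R F x"
      using assms[OF Asym_in_Skew Asym_in_Skew, of c x 0 x]
      by (simp add: F_def linear_scale[OF linear_Asym])
  qed
  \<comment> \<open>\<open>Asym\<close> doubles skew matrices, and the argument 1/2 compensates for
    this.\<close>
  define v where "v = adjoint F (1/2)"
  have "f x = skew_inner x (Asym v)" if "x \<in> Skew" for x
  proof -
    have "f x = F x / 2"
      using assms[OF that that, of 2 0] by (simp add: F_def Asym_Skew[OF that])
    also have "\<dots> = x \<bullet> v"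
      using adjoint_works[OF \<open>linear F\<close>, of x "1/2"] by (simp add: v_def)
    finally show ?thesis by (simp add: skew_inner_Asym_right[OF that])
  qed
  then show ?thesis using that Asym_in_Skew by blast
qed

lemma skew_adjoint_eqI:
  assumes "v \<in> Skew" "\<And>x. x \<in> Skew \<Longrightarrow> skew_inner (F x) w = skew_inner v x"
  shows "skew_adjoint F w = v"
  unfolding skew_adjoint_def adjoint_on_def
proof (rule the_equality)
  show "v \<in> Skew \<and> (\<forall>x\<in>Skew. skew_inner (F x) w = skew_inner x v)"
    using assms by (simp add: skew_inner_eq_inner inner_commute)
  show "v' = v" if "v' \<in> Skew \<and> (\<forall>x\<in>Skew. skew_inner (F x) w = skew_inner x v')" for v'
    using that assms by (intro skew_inner_eqI) (simp_all add: skew_inner_eq_inner inner_commute)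
qed

text \<open>The dual of \<open>dpolar_mult_left\<close>, obtained by writing B = g (g^T B).\<close>

lemma dpolar_adjoint_mult_left:
  assumes "g \<in> SO" "0 < det A"
  shows "dpolar_adjoint (g ** A) S = g ** dpolar_adjoint A S"
proof (rule vector_eq_ldot[THEN iffD1], rule allI)
  fix B
  have "0 < det (g ** A)" using assms(2) SO_D(3)[OF assms(1)] by (simp add: det_mul)
  then have "B \<bullet> dpolar_adjoint (g ** A) S = skew_inner (dpolar (g ** A) (g ** (transpose g ** B))) S"
    by (simp add: dpolar_adjoint SO_cancel(2)[OF assms(1)])
  also have "\<dots> = (transpose g ** B) \<bullet> dpolar_adjoint A S"
    by (simp add: dpolar_mult_left assms dpolar_adjoint)
  finally show "B \<bullet> dpolar_adjoint (g ** A) S = B \<bullet> (g ** dpolar_adjoint A S)"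
    by (simp add: inner_matrix_left)
qed

section \<open>Families of skew matrices and the inverse of \<open>\<Phi>\<close>\<close>

lemma restrict_in_Skew_power: "(\<And>i. i \<in> {1..s} \<Longrightarrow> f i \<in> Skew) \<Longrightarrow> (\<lambda>i\<in>{1..s}. f i) \<in> Skew_power s"
  by (auto simp: Skew_power_def)

lemma Skew_power_D: "X \<in> Skew_power s \<Longrightarrow> i \<in> {1..s} \<Longrightarrow> X i \<in> Skew"
  by (auto simp: Skew_power_def)

lemma Skew_power_eqI:
  "X \<in> Skew_power s \<Longrightarrow> Y \<in> Skew_power s \<Longrightarrow> (\<And>i. i \<in> {1..s} \<Longrightarrow> X i = Y i) \<Longrightarrow> X = Y"
  unfolding Skew_power_def by (rule PiE_ext)

locale stage_data =
  fixes s :: nat and h :: real and a :: "nat \<Rightarrow> nat \<Rightarrow> real" and g0 :: "real^'n^'n"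
    and U \<Omega> :: "nat \<Rightarrow> real^'n^'n"
  assumes det_pos: "\<And>i. i \<in> {1..s} \<Longrightarrow> 0 < det (rk_point s h (a i) g0 U \<Omega>)"
    and phi_invertible: "phi_invertible s h a g0 U \<Omega>"
begin

abbreviation "A \<equiv> \<lambda>i. rk_point s h (a i) g0 U \<Omega>"
abbreviation "\<Phi> \<equiv> phi_map s h a g0 U \<Omega>"
abbreviation "\<Phi>_inv \<equiv> phi_inverse s h a g0 U \<Omega>"

text \<open>With \<open>\<Theta>\<^sub>j = U\<^sub>j\<^sup>T\<close> the reduced stage equations involve the original stage points.\<close>

abbreviation "solves \<equiv> stage_solution s h a A (\<lambda>j. transpose (U j)) \<Omega>"

lemma phi_inverse:
  assumes "Y \<in> Skew_power s"
  shows "\<Phi>_inv Y \<in> Skew_power s" "\<Phi> (\<Phi>_inv Y) = Y"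
  using assms phi_invertible bij_betw_imp_surj_on inv_into_into f_inv_into_f
  unfolding phi_invertible_def phi_inverse_def by metis+

lemma phi_inverse_eqI:
  assumes "X \<in> Skew_power s" "\<Phi> X = Y"
  shows "\<Phi>_inv Y = X"
  using assms phi_invertible bij_betw_inv_into_left
  unfolding phi_invertible_def phi_inverse_def by fastforce

text \<open>Linearity of \<open>\<Phi>\<close>. Members of \<open>Skew_power\<close> are
  extensional, so combinations are restricted explicitly to remain in that set.\<close>

lemma phi_map_sum:
  assumes "i \<in> {1..s}"
  shows "\<Phi> (\<lambda>m\<in>{1..s}. \<Sum>j\<in>J. c j *\<^sub>R W j m) i = (\<Sum>j\<in>J. c j *\<^sub>R \<Phi> (W j) i)"
proof -
  note lin = linear_dpolar[OF det_pos[OF assms]]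
  have "h *\<^sub>R (\<Sum>l=1..s. a i l *\<^sub>R (U l ** (\<Sum>j\<in>J. c j *\<^sub>R W j l) ** \<Omega> l))
      = (\<Sum>l=1..s. \<Sum>j\<in>J. c j *\<^sub>R h *\<^sub>R a i l *\<^sub>R (U l ** W j l ** \<Omega> l))"
    by (simp add: matrix_mult.sum_left matrix_mult.sum_right matrix_mult.scaleR_left
        matrix_mult.scaleR_right scaleR_sum_right mult.commute mult.left_commute)
  also have "\<dots> = (\<Sum>j\<in>J. c j *\<^sub>R h *\<^sub>R (\<Sum>l=1..s. a i l *\<^sub>R (U l ** W j l ** \<Omega> l)))"
    by (subst sum.swap) (simp add: scaleR_sum_right)
  finally have *: "h *\<^sub>R (\<Sum>l=1..s. a i l *\<^sub>R (U l ** (\<Sum>j\<in>J. c j *\<^sub>R W j l) ** \<Omega> l))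
      = (\<Sum>j\<in>J. c j *\<^sub>R h *\<^sub>R (\<Sum>l=1..s. a i l *\<^sub>R (U l ** W j l ** \<Omega> l)))" .
  have "\<Phi> (\<lambda>m\<in>{1..s}. \<Sum>j\<in>J. c j *\<^sub>R W j m) i = (\<Sum>j\<in>J. c j *\<^sub>R W j i)
      - dpolar (A i) (h *\<^sub>R (\<Sum>l=1..s. a i l *\<^sub>R (U l ** (\<Sum>j\<in>J. c j *\<^sub>R W j l) ** \<Omega> l)))"
    unfolding phi_map_def restrict_apply'[OF assms]
    by (intro arg_cong2[where f = "(-)"] arg_cong[where f = "dpolar _"]
        arg_cong[where f = "(*\<^sub>R) h"] sum.cong refl) simp
  also have "\<dots> = (\<Sum>j\<in>J. c j *\<^sub>R \<Phi> (W j) i)"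
    unfolding * using assms
    by (simp add: phi_map_def linear_sum[OF lin] linear_scale[OF lin] scaleR_diff_right
        sum_subtractf)
  finally show ?thesis .
qed

text \<open>The combination of the preimages is a preimage of the combination, and injectivity
  identifies it.\<close>

lemma phi_inverse_sum:
  assumes "\<And>j. j \<in> J \<Longrightarrow> W j \<in> Skew_power s" "i \<in> {1..s}"
  shows "\<Phi>_inv (\<lambda>m\<in>{1..s}. \<Sum>j\<in>J. c j *\<^sub>R W j m) i = (\<Sum>j\<in>J. c j *\<^sub>R \<Phi>_inv (W j) i)"
proof -
  let ?X = "\<lambda>m\<in>{1..s}. \<Sum>j\<in>J. c j *\<^sub>R \<Phi>_inv (W j) m"
  have "?X \<in> Skew_power s"
    by (intro restrict_in_Skew_power subspace_sum subspace_scale subspace_Skew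
        Skew_power_D[OF phi_inverse(1)] assms(1)) auto
  moreover have "\<Phi> ?X = (\<lambda>m\<in>{1..s}. \<Sum>j\<in>J. c j *\<^sub>R W j m)"
  proof
    fix m
    show "\<Phi> ?X m = (\<lambda>m\<in>{1..s}. \<Sum>j\<in>J. c j *\<^sub>R W j m) m"
    proof (cases "m \<in> {1..s}")
      case True
      then show ?thesis
        by (subst phi_map_sum) (auto simp: phi_inverse(2) assms(1) intro!: sum.cong)
    next
      case False
      then show ?thesis by (auto simp: phi_map_def)
    qed
  qed
  ultimately have "\<Phi>_inv (\<lambda>m\<in>{1..s}. \<Sum>j\<in>J. c j *\<^sub>R W j m) = ?X"
    by (rule phi_inverse_eqI)
  then show ?thesis using assms(2) by simp
qed

text \<open>The left-hand side of the stage equations is the adjoint of \<open>\<Phi>\<close> applied to \<open>Sv\<close>.\<close>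

lemma phi_map_adjoint:
  assumes "\<And>j. j \<in> {1..s} \<Longrightarrow> X j \<in> Skew"
  shows "(\<Sum>j=1..s. skew_inner (X j) (Sv j - Asym (h *\<^sub>R (transpose (U j) **
            (\<Sum>l=1..s. a l j *\<^sub>R dpolar_adjoint (A l) (Sv l)) ** transpose (\<Omega> j)))))
       = (\<Sum>l=1..s. skew_inner (\<Phi> X l) (Sv l))"
proof -
  \<comment> \<open>The coupling between stages \<open>l\<close> and \<open>j\<close>; the two sides
    of the claim sum it in opposite orders.\<close>
  define c where "c l j = h * (a l j * ((U j ** X j ** \<Omega> j) \<bullet> dpolar_adjoint (A l) (Sv l)))" for l j
  have 1: "skew_inner (X j) (Asym (h *\<^sub>R (transpose (U j) **
      (\<Sum>l=1..s. a l j *\<^sub>R dpolar_adjoint (A l) (Sv l)) ** transpose (\<Omega> j)))) = (\<Sum>l=1..s. c l j)"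
    if "j \<in> {1..s}" for j
  proof -
    have "X j \<bullet> (transpose (U j) ** K ** transpose (\<Omega> j)) = (U j ** X j ** \<Omega> j) \<bullet> K" for K
      by (simp only: inner_matrix_right[of "U j ** X j"] inner_matrix_left[of "U j"]
          matrix_mul_assoc)
    then show ?thesis
      by (simp add: skew_inner_Asym_right[OF assms[OF that]] c_def inner_sum_right sum_distrib_left)
  qed
  have 2: "skew_inner (dpolar (A l) (h *\<^sub>R (\<Sum>j=1..s. a l j *\<^sub>R (U j ** X j ** \<Omega> j)))) (Sv l)
      = (\<Sum>j=1..s. c l j)" if "l \<in> {1..s}" for l
    by (simp add: dpolar_adjoint[OF det_pos[OF that], symmetric] c_def inner_sum_left sum_distrib_left)
  have diff: "skew_inner x (y - z) = skew_inner x y - skew_inner x z"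
    "skew_inner (y - z) x = skew_inner y x - skew_inner z x" for x y z :: "real^'n^'n"
    by (simp_all add: skew_inner_eq_inner inner_diff_left inner_diff_right diff_divide_distrib)
  have "(\<Sum>j=1..s. skew_inner (X j) (Sv j - Asym (h *\<^sub>R (transpose (U j) **
            (\<Sum>l=1..s. a l j *\<^sub>R dpolar_adjoint (A l) (Sv l)) ** transpose (\<Omega> j)))))
      = (\<Sum>j=1..s. skew_inner (X j) (Sv j) - (\<Sum>l=1..s. c l j))"
    by (intro sum.cong refl) (simp only: diff 1)
  also have "\<dots> = (\<Sum>l=1..s. skew_inner (X l) (Sv l) - (\<Sum>j=1..s. c l j))"
    by (simp only: sum_subtractf sum.swap[of "\<lambda>j l. c l j"])
  also have "\<dots> = (\<Sum>l=1..s. skew_inner (\<Phi> X l) (Sv l))"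
    by (intro sum.cong refl) (simp only: phi_map_def restrict_apply' diff 2)
  finally show ?thesis .
qed

text \<open>By \<open>phi_map_adjoint\<close>, substituting \<open>X = \<Phi>_inv Y\<close> turns
  the stage system into a weak form: \<open>Sv\<close> represents a linear functional of
  \<open>Y\<close>.\<close>

lemma solves_iff:
  assumes "Sv \<in> Skew_power s" "i \<in> {1..s}" "S \<in> Skew"
  shows "solves i S Sv \<longleftrightarrow>
    (\<forall>Y\<in>Skew_power s. (\<Sum>l=1..s. skew_inner (Y l) (Sv l)) = skew_inner (\<Phi>_inv Y i) S)"
proof
  let ?E = "\<lambda>j. Sv j - Asym (h *\<^sub>R (transpose (U j) **
            (\<Sum>l=1..s. a l j *\<^sub>R dpolar_adjoint (A l) (Sv l)) ** transpose (\<Omega> j)))"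
  have delta: "(\<Sum>j=1..s. skew_inner (X j) (if i = j then S else 0)) = skew_inner (X i) S" for X
  proof -
    have "skew_inner (X j) (if i = j then S else 0) = (if i = j then skew_inner (X j) S else 0)" for j
      by (simp add: skew_inner_eq_inner)
    then show ?thesis using assms(2) by (simp add: sum.delta)
  qed
  {
    assume "solves i S Sv"
    then have E: "?E j = (if i = j then S else 0)" if "j \<in> {1..s}" for j
      using that by (simp add: stage_solution_def)
    show "\<forall>Y\<in>Skew_power s. (\<Sum>l=1..s. skew_inner (Y l) (Sv l)) = skew_inner (\<Phi>_inv Y i) S"
    proof
      fix Y :: "nat \<Rightarrow> real^'n^'n" assume Y: "Y \<in> Skew_power s"
      have "(\<Sum>l=1..s. skew_inner (Y l) (Sv l)) = (\<Sum>j=1..s. skew_inner (\<Phi>_inv Y j) (?E j))"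
        using phi_map_adjoint[of "\<Phi>_inv Y" Sv] Skew_power_D[OF phi_inverse(1)[OF Y]] phi_inverse(2)[OF Y]
        by simp
      also have "\<dots> = (\<Sum>j=1..s. skew_inner (\<Phi>_inv Y j) (if i = j then S else 0))"
        by (intro sum.cong refl) (simp only: E)
      finally show "(\<Sum>l=1..s. skew_inner (Y l) (Sv l)) = skew_inner (\<Phi>_inv Y i) S"
        by (simp only: delta)
    qed
  }
  assume R: "\<forall>Y\<in>Skew_power s. (\<Sum>l=1..s. skew_inner (Y l) (Sv l)) = skew_inner (\<Phi>_inv Y i) S"
  have "?E j = (if i = j then S else 0)" if j: "j \<in> {1..s}" for j
  proof (rule skew_inner_eqI)
    show "?E j \<in> Skew" "(if i = j then S else 0) \<in> Skew"
      using subspace_diff[OF subspace_Skew Skew_power_D[OF assms(1) j] Asym_in_Skew] assms(3)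
        subspace_0[OF subspace_Skew] by auto
    fix x :: "real^'n^'n" assume x: "x \<in> Skew"
    \<comment> \<open>The family concentrated at stage \<open>j\<close> isolates the equation with
      index \<open>j\<close>.\<close>
    define X where "X = (\<lambda>m\<in>{1..s}. if m = j then x else 0)"
    have X: "X \<in> Skew_power s"
      unfolding X_def using x subspace_0[OF subspace_Skew] by (intro restrict_in_Skew_power) auto
    have "\<Phi> X \<in> Skew_power s"
      using X phi_invertible bij_betwE unfolding phi_invertible_def by blast
    have "skew_inner (X m) (?E m) = (if m = j then skew_inner x (?E m) else 0)" if "m \<in> {1..s}" for m
      using that by (simp add: X_def skew_inner_eq_inner)
    then have "(\<Sum>m=1..s. skew_inner (X m) (?E m)) = (\<Sum>m=1..s. if m = j then skew_inner x (?E m) else 0)"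
      by (intro sum.cong refl)
    then have "skew_inner x (?E j) = (\<Sum>m=1..s. skew_inner (X m) (?E m))"
      using j by (subst (asm) sum.delta) auto
    also have "\<dots> = (\<Sum>l=1..s. skew_inner (\<Phi> X l) (Sv l))"
      by (rule phi_map_adjoint) (rule Skew_power_D[OF X])
    also have "\<dots> = skew_inner (X i) S"
      using R \<open>\<Phi> X \<in> Skew_power s\<close> phi_inverse_eqI[OF X refl] by simp
    also have "\<dots> = skew_inner x (if i = j then S else 0)"
      using assms(2) by (simp add: X_def skew_inner_eq_inner)
    finally show "skew_inner (?E j) x = skew_inner (if i = j then S else 0) x"
      by (simp only: skew_inner_eq_inner inner_commute)
  qed
  then show "solves i S Sv" using assms(1) by (simp add: stage_solution_def)
qed

text \<open>By \<open>solves_iff\<close> a solution is a Riesz representative on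
  \<open>Skew_power\<close>. It is built stage by stage, and the difference of two solutions is
  tested against itself.\<close>

lemma ex1_solves:
  assumes "i \<in> {1..s}" "S \<in> Skew"
  shows "\<exists>!Sv. solves i S Sv"
proof -
  define e where "e j y = (\<lambda>m\<in>{1..s}. if m = j then y else (0 :: real^'n^'n))" for j y
  have e: "e j y \<in> Skew_power s" if "y \<in> Skew" for j y
    unfolding e_def using that subspace_0[OF subspace_Skew] by (intro restrict_in_Skew_power) auto
  have "\<exists>v\<in>Skew. \<forall>y\<in>Skew. skew_inner (\<Phi>_inv (e j y) i) S = skew_inner y v" for j
  proof -
    have "skew_inner (\<Phi>_inv (e j (c *\<^sub>R x + d *\<^sub>R y)) i) S
        = c * skew_inner (\<Phi>_inv (e j x) i) S + d * skew_inner (\<Phi>_inv (e j y) i) S"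
      if "x \<in> Skew" "y \<in> Skew" for x y c d
    proof -
      \<comment> \<open>The two-term combination is written as a sum over the booleans to match
        \<open>phi_inverse_sum\<close>.\<close>
      have "e j (c *\<^sub>R x + d *\<^sub>R y) = (\<lambda>m\<in>{1..s}. \<Sum>b\<in>UNIV. (if b then c else d) *\<^sub>R e j (if b then x else y) m)"
        by (auto simp: e_def UNIV_bool)
      then have "\<Phi>_inv (e j (c *\<^sub>R x + d *\<^sub>R y)) i = c *\<^sub>R \<Phi>_inv (e j x) i + d *\<^sub>R \<Phi>_inv (e j y) i"
        using phi_inverse_sum[where J = UNIV and c = "\<lambda>b. if b then c else d"
            and W = "\<lambda>b. e j (if b then x else y)", OF _ assms(1)] that e
        by (simp add: UNIV_bool add.commute)
      then show ?thesis
        by (simp add: skew_inner_eq_inner inner_add_left add_divide_distrib)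
    qed
    then obtain v where "v \<in> Skew" "\<And>y. y \<in> Skew \<Longrightarrow> skew_inner (\<Phi>_inv (e j y) i) S = skew_inner y v"
      using Riesz_Skew[of "\<lambda>y. skew_inner (\<Phi>_inv (e j y) i) S"] by metis
    then show ?thesis by blast
  qed
  then obtain v where v: "\<And>j. v j \<in> Skew"
    "\<And>j y. y \<in> Skew \<Longrightarrow> skew_inner (\<Phi>_inv (e j y) i) S = skew_inner y (v j)" by metis
  define Sv where "Sv = restrict v {1..s}"
  have Sv: "Sv \<in> Skew_power s" unfolding Sv_def using v(1) by (rule restrict_in_Skew_power)
  have "(\<Sum>l=1..s. skew_inner (Y l) (Sv l)) = skew_inner (\<Phi>_inv Y i) S" if Y: "Y \<in> Skew_power s" for Y
  proof -
    \<comment> \<open>\<open>Y\<close> is split into its single-stage parts, on which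
      \<open>v\<close> is known to represent the functional.\<close>
    have "(\<Sum>j=1..s. 1 *\<^sub>R e j (Y j) m) = Y m" if "m \<in> {1..s}" for m
      using that by (simp add: e_def sum.delta')
    then have "(\<lambda>m\<in>{1..s}. \<Sum>j=1..s. 1 *\<^sub>R e j (Y j) m) = Y"
      using Y by (intro Skew_power_eqI[OF restrict_in_Skew_power Y]) (auto simp: Skew_power_D)
    then have "\<Phi>_inv Y i = (\<Sum>j=1..s. 1 *\<^sub>R \<Phi>_inv (e j (Y j)) i)"
      using phi_inverse_sum[where J = "{1..s}" and c = "\<lambda>_. 1" and W = "\<lambda>j. e j (Y j)", OF _ assms(1)]
        e Skew_power_D[OF Y] by simp
    then have "skew_inner (\<Phi>_inv Y i) S = (\<Sum>j=1..s. skew_inner (\<Phi>_inv (e j (Y j)) i) S)"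
      by (simp add: skew_inner_eq_inner inner_sum_left sum_divide_distrib)
    also have "\<dots> = (\<Sum>j=1..s. skew_inner (Y j) (Sv j))"
      by (intro sum.cong refl) (simp add: v(2) Skew_power_D[OF Y] Sv_def)
    finally show ?thesis by simp
  qed
  then have "solves i S Sv" using solves_iff[OF Sv assms] by blast
  moreover have "Sv' = Sv''" if "solves i S Sv'" "solves i S Sv''" for Sv' Sv''
  proof -
    have P: "Sv' \<in> Skew_power s" "Sv'' \<in> Skew_power s"
      using that by (auto simp: stage_solution_def)
    define Y where "Y = (\<lambda>l\<in>{1..s}. Sv' l - Sv'' l)"
    have "Y \<in> Skew_power s"
      unfolding Y_def by (intro restrict_in_Skew_power subspace_diff[OF subspace_Skew] Skew_power_D[OF P(1)]
          Skew_power_D[OF P(2)])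
    then have "(\<Sum>l=1..s. skew_inner (Y l) (Sv' l)) = (\<Sum>l=1..s. skew_inner (Y l) (Sv'' l))"
      using bspec[OF iffD1[OF solves_iff[OF P(1) assms] that(1)]]
        bspec[OF iffD1[OF solves_iff[OF P(2) assms] that(2)]] by (simp only:)
    then have "(\<Sum>l=1..s. skew_inner (Y l) (Sv' l) - skew_inner (Y l) (Sv'' l)) = 0"
      by (simp add: sum_subtractf)
    moreover have "skew_inner (Y l) (Sv' l) - skew_inner (Y l) (Sv'' l) = (Y l \<bullet> Y l) / 2"
      if "l \<in> {1..s}" for l
      using that by (simp add: Y_def skew_inner_eq_inner inner_diff_right diff_divide_distrib)
    then have "(\<Sum>l=1..s. skew_inner (Y l) (Sv' l) - skew_inner (Y l) (Sv'' l)) = (\<Sum>l=1..s. (Y l \<bullet> Y l) / 2)"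
      by (intro sum.cong refl)
    ultimately have "(\<Sum>l=1..s. (Y l \<bullet> Y l) / 2) = 0" by (simp only:)
    then have "\<forall>l\<in>{1..s}. (Y l \<bullet> Y l) / 2 = 0"
      by (subst (asm) sum_nonneg_eq_0_iff) auto
    then show ?thesis
      by (intro Skew_power_eqI[OF P]) (auto simp: Y_def)
  qed
  ultimately show ?thesis by blast
qed

text \<open>Serves both maps of the unreduced integrator: \<open>psi_map\<close> with
  \<open>C l = a l k *\<^sub>R U k\<close>, and \<open>varphi_map\<close> with
  \<open>C l = g0\<close>.\<close>

lemma skew_inner_phi_inverse:
  assumes "i \<in> {1..s}" "S \<in> Skew" "\<delta> \<in> Skew"
  shows "skew_inner (\<Phi>_inv (\<lambda>l\<in>{1..s}. dpolar (A l) (C l ** \<delta>)) i) S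
    = skew_inner (Asym (\<Sum>l=1..s. transpose (C l) ** dpolar_adjoint (A l) ((THE Sv. solves i S Sv) l))) \<delta>"
proof -
  define Sv where "Sv = (THE Sv. solves i S Sv)"
  have sol: "solves i S Sv" unfolding Sv_def by (rule theI'[OF ex1_solves[OF assms(1,2)]])
  then have Sv: "Sv \<in> Skew_power s" by (simp add: stage_solution_def)
  let ?Y = "\<lambda>l\<in>{1..s}. dpolar (A l) (C l ** \<delta>)"
  have "?Y \<in> Skew_power s"
    by (intro restrict_in_Skew_power dpolar_Skew det_pos)
  then have "skew_inner (\<Phi>_inv ?Y i) S = (\<Sum>l=1..s. skew_inner (?Y l) (Sv l))"
    using bspec[OF iffD1[OF solves_iff[OF Sv assms(1,2)] sol]] by (simp only:)
  also have "\<dots> = (\<Sum>l=1..s. \<delta> \<bullet> (transpose (C l) ** dpolar_adjoint (A l) (Sv l)))"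
    by (intro sum.cong refl) (simp add: dpolar_adjoint[OF det_pos, symmetric] inner_matrix_left)
  also have "\<dots> = skew_inner \<delta> (Asym (\<Sum>l=1..s. transpose (C l) ** dpolar_adjoint (A l) (Sv l)))"
    by (simp add: skew_inner_Asym_right[OF assms(3)] inner_sum_right)
  finally show ?thesis by (simp add: Sv_def skew_inner_eq_inner inner_commute)
qed

text \<open>The argument carries a minus sign because the unreduced equations contain minus an
  \<open>Asym\<close> term once the left gradient vanishes.\<close>

lemma skew_adjoint_psi:
  assumes "i \<in> {1..s}" "S \<in> Skew"
  shows "skew_adjoint (pi_map i \<circ> \<Phi>_inv \<circ> psi_map s h a g0 U \<Omega> k) (- S)
    = - T_map s h a A (\<lambda>j. transpose (U j)) \<Omega> i k S"
proof (rule skew_adjoint_eqI)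
  show "- T_map s h a A (\<lambda>j. transpose (U j)) \<Omega> i k S \<in> Skew"
    unfolding T_map_def Let_def by (intro subspace_neg[OF subspace_Skew] Asym_in_Skew)
  fix \<delta> :: "real^'n^'n" assume "\<delta> \<in> Skew"
  from skew_inner_phi_inverse[OF assms this, of "\<lambda>l. a l k *\<^sub>R U k"]
  show "skew_inner ((pi_map i \<circ> \<Phi>_inv \<circ> psi_map s h a g0 U \<Omega> k) \<delta>) (- S)
    = skew_inner (- T_map s h a A (\<lambda>j. transpose (U j)) \<Omega> i k S) \<delta>"
    by (simp add: T_map_def Let_def pi_map_def psi_map_def skew_inner_eq_inner transpose_scalar
        matrix_mult.scaleR_left matrix_mult.scaleR_right matrix_mult.sum_right)
qed

lemma skew_adjoint_varphi:
  assumes "i \<in> {1..s}" "S \<in> Skew"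
  shows "skew_adjoint (pi_map i \<circ> \<Phi>_inv \<circ> varphi_map s h a g0 U \<Omega>) (- S)
    = - R_map s h a A (\<lambda>j. transpose (U j)) \<Omega> (transpose g0) i S"
proof (rule skew_adjoint_eqI)
  show "- R_map s h a A (\<lambda>j. transpose (U j)) \<Omega> (transpose g0) i S \<in> Skew"
    unfolding R_map_def Let_def by (intro subspace_neg[OF subspace_Skew] Asym_in_Skew)
  fix \<delta> :: "real^'n^'n" assume "\<delta> \<in> Skew"
  from skew_inner_phi_inverse[OF assms this, of "\<lambda>l. g0"]
  show "skew_inner ((pi_map i \<circ> \<Phi>_inv \<circ> varphi_map s h a g0 U \<Omega>) \<delta>) (- S)
    = skew_inner (- R_map s h a A (\<lambda>j. transpose (U j)) \<Omega> (transpose g0) i S) \<delta>"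
    by (simp add: R_map_def Let_def pi_map_def varphi_map_def skew_inner_eq_inner
        matrix_mult.sum_right)
qed

end

section \<open>Invariance\<close>

lemma Ck_on_bounded_linear:
  assumes "bounded_linear T"
  shows "Ck_on k F W \<Longrightarrow> Ck_on k (\<lambda>x. T (F x)) W"
proof (induction k arbitrary: F)
  case 0
  then show ?case using bounded_linear.continuous_on[OF assms] by simp
next
  case (Suc k)
  then obtain F' where "\<forall>x\<in>W. (F has_derivative F' x) (at x)" "\<forall>v. Ck_on k (\<lambda>x. F' x v) W"
    by auto
  then show ?case
    unfolding Ck_on.simps
    by (intro exI[of _ "\<lambda>x v. T (F' x v)"] conjI ballI allI bounded_linear.has_derivative[OF assms]
        Suc.IH) auto
qed

lemma smooth_map_on_bounded_linear:
  assumes "bounded_linear T" "smooth_map_on X f"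
  shows "smooth_map_on X (\<lambda>x. T (f x))"
  using assms(2) Ck_on_bounded_linear[OF assms(1)] unfolding smooth_map_on_def by metis

text \<open>The full and the reduced Hamiltonian are known to agree only on \<open>Skew\<close>;
  this suffices because the gradient is taken within \<open>Skew\<close>.\<close>

lemma skew_grad_cong:
  assumes "\<And>Y. Y \<in> Skew \<Longrightarrow> f Y = g Y" "X \<in> Skew"
  shows "skew_grad f X = skew_grad g X"
proof -
  have "(f has_derivative D) (at X within Skew) \<longleftrightarrow> (g has_derivative D) (at X within Skew)" for D
    using has_derivative_transform[OF assms(2), of f g] has_derivative_transform[OF assms(2), of g f]
      assms(1) by auto
  then show ?thesis by (simp add: skew_grad_def)
qed

lemma rk_point_mult_left:
  "rk_point s h w (g ** g0) (\<lambda>i. g ** U i) \<Omega> = g ** rk_point s h w g0 U \<Omega>"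
  by (simp add: rk_point_def matrix_mult.add_right matrix_mult.scaleR_right matrix_mult.sum_right
      matrix_mul_assoc)

lemma feasible_mult_left:
  assumes g: "g \<in> SO" and f: "feasible s h a b g0 g1 \<Omega> U"
  shows "feasible s h a b (g ** g0) (g ** g1) \<Omega> (\<lambda>i. g ** U i)"
  using f by (auto simp: feasible_def rk_point_mult_left det_mul SO_D(3)[OF g] polar_mult_left[OF g]
      SO_mult[OF g])

text \<open>The converse is the forward direction for the inverse rotation.\<close>

lemma feasible_mult_left_iff:
  assumes "g \<in> SO"
  shows "feasible s h a b (g ** g0) (g ** g1) \<Omega> (\<lambda>i. g ** U i) \<longleftrightarrow> feasible s h a b g0 g1 \<Omega> U"
  using feasible_mult_left[OF assms, of s h a b g0 g1 \<Omega> U]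
    feasible_mult_left[OF SO_transpose[OF assms], of s h a b "g ** g0" "g ** g1" \<Omega> "\<lambda>i. g ** U i"]
  by (auto simp: SO_cancel(1)[OF assms])

text \<open>A variation of the translated problem is pulled back by g^T, a linear map, so it stays
  smooth. The objective depends on \<Omega> alone and does not change.\<close>

lemma stationary_mult_left:
  assumes g: "g \<in> SO" and st: "stationary s h a b l g0 g1 \<Omega> U"
  shows "stationary s h a b l (g ** g0) (g ** g1) \<Omega> (\<lambda>i. g ** U i)"
  unfolding stationary_def
proof (intro conjI allI impI)
  show "feasible s h a b (g ** g0) (g ** g1) \<Omega> (\<lambda>i. g ** U i)"
    using st feasible_mult_left[OF g] by (simp add: stationary_def)
  fix \<epsilon> :: real and \<Omega>v Uv :: "nat \<Rightarrow> real \<Rightarrow> real^'a^'a"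
  assume \<epsilon>: "0 < \<epsilon>" and v: "(\<forall>i\<in>{1..s}. smooth_map_on {-\<epsilon><..<\<epsilon>} (\<Omega>v i) \<and> smooth_map_on {-\<epsilon><..<\<epsilon>} (Uv i) \<and>
            \<Omega>v i 0 = \<Omega> i \<and> Uv i 0 = g ** U i) \<and>
        (\<forall>t\<in>{-\<epsilon><..<\<epsilon>}. feasible s h a b (g ** g0) (g ** g1) (\<lambda>i. \<Omega>v i t) (\<lambda>i. Uv i t))"
  let ?W = "\<lambda>i t. transpose g ** Uv i t"
  have "\<forall>i\<in>{1..s}. smooth_map_on {-\<epsilon><..<\<epsilon>} (\<Omega>v i) \<and> smooth_map_on {-\<epsilon><..<\<epsilon>} (?W i) \<and>
            \<Omega>v i 0 = \<Omega> i \<and> ?W i 0 = U i"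
    using v by (auto simp: SO_cancel(1)[OF g]
        intro: smooth_map_on_bounded_linear[OF matrix_mult.bounded_linear_right])
  moreover have "\<forall>t\<in>{-\<epsilon><..<\<epsilon>}. feasible s h a b g0 g1 (\<lambda>i. \<Omega>v i t) (\<lambda>i. ?W i t)"
  proof
    fix t assume "t \<in> {-\<epsilon><..<\<epsilon>}"
    then have "feasible s h a b (g ** g0) (g ** g1) (\<lambda>i. \<Omega>v i t) (\<lambda>i. Uv i t)" using v by blast
    from feasible_mult_left[OF SO_transpose[OF g] this]
    show "feasible s h a b g0 g1 (\<lambda>i. \<Omega>v i t) (\<lambda>i. ?W i t)" by (simp add: SO_cancel(1)[OF g])
  qed
  ultimately have "((\<lambda>t. objective s h b l (\<lambda>i. \<Omega>v i t) (\<lambda>i. ?W i t)) has_real_derivative 0) (at 0)"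
    by (rule st[unfolded stationary_def, THEN conjunct2, THEN spec, THEN mp, OF \<epsilon>, THEN spec,
          THEN spec, THEN mp, OF conjI])
  then show "((\<lambda>t. objective s h b l (\<lambda>i. \<Omega>v i t) (\<lambda>i. Uv i t)) has_real_derivative 0) (at 0)"
    by (simp add: objective_def)
qed

lemma stationary_mult_left_iff:
  assumes "g \<in> SO"
  shows "stationary s h a b l (g ** g0) (g ** g1) \<Omega> (\<lambda>i. g ** U i) \<longleftrightarrow> stationary s h a b l g0 g1 \<Omega> U"
  using stationary_mult_left[OF assms, of s h a b l g0 g1 \<Omega> U]
    stationary_mult_left[OF SO_transpose[OF assms], of s h a b l "g ** g0" "g ** g1" \<Omega> "\<lambda>i. g ** U i"]
  by (auto simp: SO_cancel(1)[OF assms])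

lemma objective_indep: "objective s h b l \<Omega> U = objective s h b l \<Omega> W"
  by (simp add: objective_def)

lemma extremal_values_mult_left:
  assumes g: "g \<in> SO"
  shows "extremal_values s h a b l (g ** g0) (g ** g1) = extremal_values s h a b l g0 g1"
proof -
  have sub: "extremal_values s h a b l g0 g1 \<subseteq> extremal_values s h a b l (g ** g0) (g ** g1)"
    if "g \<in> SO" for g g0 g1 :: "real^'a^'a"
    unfolding extremal_values_def using stationary_mult_left[OF that] objective_indep by blast
  show ?thesis
    using sub[OF g, of g0 g1] sub[OF SO_transpose[OF g], of "g ** g0" "g ** g1"]
    by (simp add: SO_cancel(1)[OF g])
qed

section \<open>The reduced integrator\<close>

text \<open>The transposes of f0 and of each \<Theta> j are g1^T g0 and g1^T (U j), so the reduced
  data are the original ones translated by g1^T.\<close>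

lemma reduced_point_eq:
  assumes f0: "f0 = transpose g0 ** g1" and \<Theta>: "\<forall>i\<in>{1..s}. \<Theta> i = transpose (U i) ** g1"
  shows "reduced_point s h w f0 \<Theta> \<Omega> = transpose g1 ** rk_point s h w g0 U \<Omega>"
proof -
  have "rk_point s h w (transpose f0) (\<lambda>j. transpose (\<Theta> j)) \<Omega>
      = rk_point s h w (transpose g1 ** g0) (\<lambda>j. transpose g1 ** U j) \<Omega>"
    unfolding rk_point_def
    by (intro arg_cong2[where f = "(+)"] arg_cong[where f = "(*\<^sub>R) h"] sum.cong refl)
       (simp_all only: f0 bspec[OF \<Theta>] matrix_transpose_mul transpose_transpose)
  then show ?thesis by (simp add: reduced_point_def rk_point_mult_left)
qed

section \<open>Transport of the stage data by g1^T\<close>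

context stage_data
begin

context
  fixes g1 f0 :: "real^'n^'n" and \<Theta> :: "nat \<Rightarrow> real^'n^'n"
  assumes g1: "g1 \<in> SO" and f0: "f0 = transpose g0 ** g1"
    and \<Theta>: "\<forall>i\<in>{1..s}. \<Theta> i = transpose (U i) ** g1"
begin

abbreviation "A_red \<equiv> \<lambda>i. reduced_point s h (a i) f0 \<Theta> \<Omega>"

text \<open>Each adjoint releases a factor g1^T by \<open>dpolar_adjoint_mult_left\<close>, which
  \<open>g1\<close> cancels.\<close>

lemma reduced_weighted_sum:
  "g1 ** (\<Sum>l=1..s. c l *\<^sub>R dpolar_adjoint (A_red l) (Sv l))
    = (\<Sum>l=1..s. c l *\<^sub>R dpolar_adjoint (A l) (Sv l))"
proof -
  have "g1 ** (c l *\<^sub>R dpolar_adjoint (A_red l) (Sv l)) = c l *\<^sub>R dpolar_adjoint (A l) (Sv l)"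
    if "l \<in> {1..s}" for l
    unfolding reduced_point_eq[OF f0 \<Theta>]
    by (simp add: dpolar_adjoint_mult_left[OF SO_transpose[OF g1] det_pos[OF that]]
        matrix_mult.scaleR_right SO_cancel(2)[OF g1])
  then show ?thesis
    unfolding matrix_mult.sum_right by (intro sum.cong refl)
qed

lemma reduced_weighted_sum_stage:
  assumes "j \<in> {1..s}"
  shows "\<Theta> j ** (\<Sum>l=1..s. c l *\<^sub>R dpolar_adjoint (A_red l) (Sv l))
    = transpose (U j) ** (\<Sum>l=1..s. c l *\<^sub>R dpolar_adjoint (A l) (Sv l))"
  by (simp only: bspec[OF \<Theta> assms] matrix_mul_assoc[symmetric] reduced_weighted_sum)

text \<open>Hence the definite descriptions in \<open>T_map\<close> and \<open>R_map\<close> pick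
  the same family before and after reduction.\<close>

lemma stage_solution_reduced: "stage_solution s h a A_red \<Theta> \<Omega> i S Sv \<longleftrightarrow> solves i S Sv"
  unfolding stage_solution_def
  by (intro conj_cong ball_cong refl) (simp only: reduced_weighted_sum_stage)

lemma T_map_reduced:
  assumes "k \<in> {1..s}"
  shows "T_map s h a A_red \<Theta> \<Omega> i k S = T_map s h a A (\<lambda>j. transpose (U j)) \<Omega> i k S"
  unfolding T_map_def stage_solution_reduced Let_def reduced_weighted_sum_stage[OF assms] ..

lemma R_map_reduced:
  "R_map s h a A_red \<Theta> \<Omega> f0 i S = R_map s h a A (\<lambda>j. transpose (U j)) \<Omega> (transpose g0) i S"
proof -
  have "f0 ** (\<Sum>l=1..s. dpolar_adjoint (A_red l) (Sv l))
      = transpose g0 ** (\<Sum>l=1..s. dpolar_adjoint (A l) (Sv l))" for Sv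
    using reduced_weighted_sum[of "\<lambda>_. 1" Sv] by (simp add: f0 matrix_mul_assoc[symmetric])
  then show ?thesis
    unfolding R_map_def stage_solution_reduced Let_def by (simp only:)
qed

text \<open>The six groups of equations are matched one by one.\<close>

lemma group_integrator_iff_reduced:
  assumes Ll: "reduced_setup L l hred"
    and U: "\<And>i. i \<in> {1..s} \<Longrightarrow> U i \<in> SO"
    and \<mu>: "\<And>i. i \<in> {1..s} \<Longrightarrow> \<mu> i \<in> Skew"
    and pos: "pos_def (transpose g1 ** rk_point s h b g0 U \<Omega>)"
  shows "group_integrator s h a b (hamiltonian L) g0 g1 U \<mu> \<Omega> \<Lambda> p0 p1
    \<longleftrightarrow> reduced_integrator s h a b hred f0 \<Theta> \<mu> \<Omega> \<Lambda> p0 p1"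
proof -
  define Z where "Z i = left_grad (\<lambda>V. hamiltonian L V (\<mu> i)) (U i)
    - Asym (transpose (U i) ** g1 ** \<Lambda> ** transpose (\<Omega> i))" for i
  define Y where "Y i = Asym (\<Theta> i ** \<Lambda> ** transpose (\<Omega> i))" for i
  have ham: "hamiltonian L V \<nu> = hred \<nu>" if "V \<in> SO" "\<nu> \<in> Skew" for V \<nu>
    using Ll that by (simp add: reduced_setup_def)
  have Y_Skew: "Y i \<in> Skew" for i unfolding Y_def by (rule Asym_in_Skew)
  \<comment> \<open>The Hamiltonian is constant in its group argument, so its left gradient drops
    out.\<close>
  have Z: "Z i = - Y i" if "i \<in> {1..s}" for i
    using left_grad_constant[OF U[OF that], of "\<lambda>V. hamiltonian L V (\<mu> i)"] ham[OF _ \<mu>[OF that]]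
    by (simp add: Z_def Y_def bspec[OF \<Theta> that])
  have red: "reduced_point s h w f0 \<Theta> \<Omega> = transpose g1 ** rk_point s h w g0 U \<Omega>" for w
    by (rule reduced_point_eq[OF f0 \<Theta>])
  have "(\<Sum>i=1..s. (b i / b k) *\<^sub>R skew_adjoint (pi_map i \<circ> \<Phi>_inv \<circ> psi_map s h a g0 U \<Omega> k) (Z i))
      = (\<Sum>i=1..s. - ((b i / b k) *\<^sub>R T_map s h a A_red \<Theta> \<Omega> i k (Y i)))" if "k \<in> {1..s}" for k
    by (intro sum.cong refl)
       (simp only: Z skew_adjoint_psi Y_Skew T_map_reduced[OF that] scaleR_minus_right)
  then have momentum: "(\<mu> k = - Asym (transpose (U k) ** g1 ** \<Lambda>) + h *\<^sub>R (\<Sum>i=1..s. (b i / b k) *\<^sub>R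
        skew_adjoint (pi_map i \<circ> \<Phi>_inv \<circ> psi_map s h a g0 U \<Omega> k) (Z i)))
      \<longleftrightarrow> (\<mu> k = - Asym (\<Theta> k ** \<Lambda>)
        - h *\<^sub>R (\<Sum>i=1..s. (b i / b k) *\<^sub>R T_map s h a A_red \<Theta> \<Omega> i k (Y i)))" if "k \<in> {1..s}" for k
    using that by (simp add: bspec[OF \<Theta> that] sum_negf)
  have "(\<Sum>i=1..s. b i *\<^sub>R skew_adjoint (pi_map i \<circ> \<Phi>_inv \<circ> varphi_map s h a g0 U \<Omega>) (Z i))
      = (\<Sum>i=1..s. - (b i *\<^sub>R R_map s h a A_red \<Theta> \<Omega> f0 i (Y i)))"
    by (intro sum.cong refl)
       (simp only: Z skew_adjoint_varphi Y_Skew R_map_reduced scaleR_minus_right)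
  then have initial: "(Asym (transpose g0 ** g1 ** \<Lambda>) = - p0 + h *\<^sub>R (\<Sum>i=1..s. b i *\<^sub>R
        skew_adjoint (pi_map i \<circ> \<Phi>_inv \<circ> varphi_map s h a g0 U \<Omega>) (Z i)))
      \<longleftrightarrow> (Asym (f0 ** \<Lambda>) = - p0 - h *\<^sub>R (\<Sum>i=1..s. b i *\<^sub>R R_map s h a A_red \<Theta> \<Omega> f0 i (Y i)))"
    by (simp add: f0 sum_negf)
  \<comment> \<open>Translating by g1^T moves the endpoint constraint to the identity, where
    positive definiteness makes it a symmetry condition.\<close>
  have "polar (rk_point s h b g0 U \<Omega>) = g1 ** polar (transpose g1 ** rk_point s h b g0 U \<Omega>)"
    using polar_mult_left[OF g1 pos_def_det[OF pos]] by (simp add: SO_cancel(2)[OF g1])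
  then have "g1 = polar (rk_point s h b g0 U \<Omega>) \<longleftrightarrow> polar (transpose g1 ** rk_point s h b g0 U \<Omega>) = mat 1"
    using SO_cancel(1)[OF g1] SO_D(1)[OF g1] by (metis matrix_mul_rid)
  also have "\<dots> \<longleftrightarrow> 0 = Asym (reduced_point s h b f0 \<Theta> \<Omega>)"
    unfolding red polar_eq_one_iff[OF pos] by (rule eq_commute)
  finally have constraint: "g1 = polar (rk_point s h b g0 U \<Omega>) \<longleftrightarrow> 0 = Asym (reduced_point s h b f0 \<Theta> \<Omega>)" .
  have stages: "U i = polar (A i) \<longleftrightarrow> transpose (\<Theta> i) = polar (A_red i)" if "i \<in> {1..s}" for i
  proof -
    have "transpose (\<Theta> i) = transpose g1 ** U i"
      by (simp add: bspec[OF \<Theta> that] matrix_transpose_mul)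
    moreover have "polar (A_red i) = transpose g1 ** polar (A i)"
      unfolding red by (rule polar_mult_left[OF SO_transpose[OF g1] det_pos[OF that]])
    ultimately show ?thesis using SO_cancel(2)[OF g1] by metis
  qed
  have final: "p1 = Asym (transpose g1 ** rk_point s h b g0 U \<Omega> ** transpose \<Lambda>)
      \<longleftrightarrow> p1 = Asym (reduced_point s h b f0 \<Theta> \<Omega> ** transpose \<Lambda>)"
    by (simp only: red)
  have legendre: "\<Omega> i = skew_grad (hamiltonian L (U i)) (\<mu> i) \<longleftrightarrow> \<Omega> i = skew_grad hred (\<mu> i)"
    if "i \<in> {1..s}" for i
    by (simp only: skew_grad_cong[OF ham[OF U[OF that]] \<mu>[OF that]])
  show ?thesis
    unfolding group_integrator_def reduced_integrator_def Let_def Z_def[symmetric] Y_def[symmetric]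
    by (intro conj_cong ball_cong refl momentum initial constraint stages final legendre)
qed

end

end

text \<open>The unique solvability included here shows that the definite descriptions in
  \<open>T_map\<close> and \<open>R_map\<close> are meaningful.\<close>

lemma reduced_integrator_equivalence:
  assumes "reduced_setup L l hred" "g1 \<in> SO" "\<forall>i\<in>{1..s}. U i \<in> SO"
    "\<forall>i\<in>{1..s}. \<mu> i \<in> Skew \<and> \<Omega> i \<in> Skew"
    "\<forall>i\<in>{1..s}. 0 < det (rk_point s h (a i) g0 U \<Omega>)" "phi_invertible s h a g0 U \<Omega>"
    "transpose g1 ** rk_point s h b g0 U \<Omega> \<in> {M. pos_def M}"
    "f0 = transpose g0 ** g1" "\<forall>i\<in>{1..s}. \<Theta> i = transpose (U i) ** g1"
  shows "(\<forall>i\<in>{1..s}. \<forall>S\<in>Skew.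
      \<exists>!Sv. stage_solution s h a (\<lambda>m. reduced_point s h (a m) f0 \<Theta> \<Omega>) \<Theta> \<Omega> i S Sv) \<and>
    (group_integrator s h a b (hamiltonian L) g0 g1 U \<mu> \<Omega> \<Lambda> p0 p1
      \<longleftrightarrow> reduced_integrator s h a b hred f0 \<Theta> \<mu> \<Omega> \<Lambda> p0 p1)"
proof -
  interpret stage_data s h a g0 U \<Omega> using assms(5,6) by unfold_locales blast+
  show ?thesis
    using ex1_solves group_integrator_iff_reduced[OF assms(2,8,9,1)] assms(3,4,7)
    unfolding stage_solution_reduced[OF assms(2,8,9)] by blast
qed

theorem mainTheorem3:
  shows
  "(\<forall>(s::nat) (h::real) (a :: nat \<Rightarrow> nat \<Rightarrow> real) (b :: nat \<Rightarrow> real)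
      (L :: real^'n^'n \<Rightarrow> real^'n^'n \<Rightarrow> real) (l :: real^'n^'n \<Rightarrow> real) (hred :: real^'n^'n \<Rightarrow> real).
      1 \<le> s \<and> 0 < h \<and> (\<forall>i\<in>{1..s}. b i \<noteq> 0) \<and> reduced_setup L l hred \<longrightarrow>
      (\<forall>g0\<in>SO. \<forall>g1\<in>SO. \<forall>g\<in>SO.
         (\<forall>\<Omega> U :: nat \<Rightarrow> real^'n^'n.
            (feasible s h a b g0 g1 \<Omega> U
               \<longleftrightarrow> feasible s h a b (g ** g0) (g ** g1) \<Omega> (\<lambda>i. g ** U i)) \<and>
            (stationary s h a b l g0 g1 \<Omega> U
               \<longleftrightarrow> stationary s h a b l (g ** g0) (g ** g1) \<Omega> (\<lambda>i. g ** U i)) \<and>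
            objective s h b l \<Omega> U = objective s h b l \<Omega> (\<lambda>i. g ** U i)) \<and>
         extremal_values s h a b l (g ** g0) (g ** g1) = extremal_values s h a b l g0 g1 \<and>
         discrete_lagrangian s h a b l (g ** g0) (g ** g1) = discrete_lagrangian s h a b l g0 g1))
   \<and>
   (\<exists>V :: (real^'n^'n) set. open V \<and> mat 1 \<in> V \<and>
     (\<forall>(s::nat) (h::real) (a :: nat \<Rightarrow> nat \<Rightarrow> real) (b :: nat \<Rightarrow> real)
        (L :: real^'n^'n \<Rightarrow> real^'n^'n \<Rightarrow> real) (l :: real^'n^'n \<Rightarrow> real) (hred :: real^'n^'n \<Rightarrow> real).
        1 \<le> s \<and> 0 < h \<and> (\<forall>i\<in>{1..s}. b i \<noteq> 0) \<and> reduced_setup L l hred \<longrightarrow>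
        (\<forall>(g0 :: real^'n^'n) g1 (U :: nat \<Rightarrow> real^'n^'n) (\<mu> :: nat \<Rightarrow> real^'n^'n)
            (\<Omega> :: nat \<Rightarrow> real^'n^'n) \<Lambda> p0 p1 f0 (\<Theta> :: nat \<Rightarrow> real^'n^'n).
           g0 \<in> SO \<and> g1 \<in> SO \<and> (\<forall>i\<in>{1..s}. U i \<in> SO) \<and>
           (\<forall>i\<in>{1..s}. \<mu> i \<in> Skew \<and> \<Omega> i \<in> Skew) \<and>
           \<Lambda> \<in> Skew \<and> p0 \<in> Skew \<and> p1 \<in> Skew \<and>
           (\<forall>i\<in>{1..s}. 0 < det (rk_point s h (a i) g0 U \<Omega>)) \<and>
           phi_invertible s h a g0 U \<Omega> \<and>
           transpose g1 ** rk_point s h b g0 U \<Omega> \<in> V \<and>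
           f0 = transpose g0 ** g1 \<and> (\<forall>i\<in>{1..s}. \<Theta> i = transpose (U i) ** g1)
           \<longrightarrow>
           (\<forall>i\<in>{1..s}. \<forall>S\<in>Skew.
              \<exists>!Sv. stage_solution s h a (\<lambda>m. reduced_point s h (a m) f0 \<Theta> \<Omega>) \<Theta> \<Omega> i S Sv) \<and>
           (group_integrator s h a b (hamiltonian L) g0 g1 U \<mu> \<Omega> \<Lambda> p0 p1
              \<longleftrightarrow> reduced_integrator s h a b hred f0 \<Theta> \<mu> \<Omega> \<Lambda> p0 p1))))"
proof (intro conjI exI[of _ "{M. pos_def M}"], goal_cases)
  case 1
  show ?case
    by (intro allI impI ballI conjI)
       (simp_all only: feasible_mult_left_iff stationary_mult_left_iff extremal_values_mult_left
         discrete_lagrangian_def objective_indep)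
next
  \<comment> \<open>The neighbourhood, the set of positive definite matrices, depends on the
    dimension only.\<close>
  case 2
  show ?case by (rule open_pos_def)
next
  case 3
  show ?case by (simp add: pos_def_one)
next
  case 4
  show ?case
    by (intro allI impI, elim conjE) (rule reduced_integrator_equivalence)
qed

end
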